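(* Let $n>m\geq1$, let $(\pi,V)$ be an $R[G_n]$-module and $(\pi',V')$ an $R[G_m]$-module, both of Whittaker type, with $\pi'$ not exceptional for $\pi$. Write $\mathcal{W}=\mathcal{W}(V,\psi_R)$, $\mathcal{W}'=\mathcal{W}(V',\psi_R^{-1})$, and regard $\mathcal{W}'$ as a representation of $H=G_mU_{n,n-m-1}$ with $U_{n,n-m-1}$ acting trivially. Then the $R$-module of $R$-bilinear maps $B:\mathcal{W}\times\mathcal{W}'\to R$ satisfying $B(hW,hW')=\chi(h)B(W,W')$ for all $h\in H$ is free of rank one, generated by \[I(W,W';0)=\sum_{g\in N_m\backslash G_m}W\begin{pmatrix}g&0\\0&I_{n-m}\end{pmatrix}W'(g).\]
   Context: Let $p$ be a prime, $q$ a power of $p$, $G_n=\mathrm{GL}_n(\mathbb{F}_q)$, $R$ a commutative Noetherian $\mathbb{Z}[\frac1p,\zeta_p]$-algebra with $0\neq1$ ($\zeta_p$ a primitive $p$-th root of unity). Fix nontrivial $\psi:(\mathbb{F}_q,+)\to\mathbb{Z}[\frac1p,\zeta_p]^\times$ and let $\psi_R$ be its image in $R^\times$. $N_n$ is the upper unipotent subgroup, with character $\psi_R(u)=\psi_R(\sum_{i=1}^{n-1}u_{i,i+1})$; the same formula defines $\psi_R$ on $U_{n,n-m-1}=\{\begin{psmallmatrix}I_{m+1}&z\\0&y\end{psmallmatrix}: z\in\mathrm{Mat}_{m+1,n-m-1}(\mathbb{F}_q), y\in N_{n-m-1}\}$. $G_m$ is embedded in $G_n$ in the top left corner; it normalizes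 $U_{n,n-m-1}$, and $\chi$ is the character of $H=G_mU_{n,n-m-1}$ trivial on $G_m$ and equal to $\psi_R$ on $U_{n,n-m-1}$. $H$ acts on $\mathcal W$ by right translation. $P_n$ is the mirabolic subgroup (last row $(0,\dots,0,1)$), $U_n=\{\begin{psmallmatrix}I_{n-1}&y\\0&1\end{psmallmatrix}\}$ with $\psi_R$ given by $y_{n-1}$. For an $R[P_n]$-module $V$: $\Phi^-(V)=V/\langle uv-\psi_R(u)v\rangle_{u\in U_n}$ (an $R[P_{n-1}]$-module), $\Psi^-(V)=V/\langle uv-v\rangle_{u\in U_n}$ (an $R[G_{n-1}]$-module), $V^{(k)}=\Psi^-(\Phi^-)^{k-1}(V)\in\mathrm{Rep}_R(G_{n-k})$ for $1\le k\le n$, $V^{(0)}=V$; for $G_n$-modules use the restriction to $P_n$. $V^{(n)}$ is the $(N_n,\psi_R)$-coinvariants. $V$ is of Whittaker type if $V^{(n)}$ is free of rank one over $R$; then a generator $\lambda$ of $\mathrm{Hom}_R(V^{(n)},R)$ gives $V\to\mathrm{Ind}_{N_n}^{G_n}\psi_R$, $v\mapsto(g\mapsto\lambda(\overline{gv}))$, whose image is the Whittaker model $\mathcal{W}(V,\psi_R)$. Replacing $\psi_R$ by $\psi_R^{-1}$ gives derivatives with respect to $\psi_R^{-1}$ and $\mathcal{W}(V',\psi_R^{-1})$. $\pi'$ is exceptional for $\pi$ if for some $t\in\{1,\dots,m\}$ there is a nonzero $G_t$-invariant $R$-bilinear form on $\mathcal{W}(V,\psi_R)^{(n-t)}\times\mathcal{W}(V',\psi_R^{-1})^{(m-t)}$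 (the latter derivative with respect to $\psi_R^{-1}$). *)

theory Defs
  imports "Jordan_Normal_Form.Matrix" "HOL-Library.Function_Algebras"
begin

definition GL :: "nat \<Rightarrow> 'k::field mat set" where
  "GL n = {A \<in> carrier_mat n n. invertible_mat A}"

definition emb :: "nat \<Rightarrow> nat \<Rightarrow> 'k::field mat \<Rightarrow> 'k mat" where
  "emb n m A = four_block_mat A (0\<^sub>m m (n - m)) (0\<^sub>m (n - m) m) (1\<^sub>m (n - m))"

definition Nuni :: "nat \<Rightarrow> 'k::field mat set" where
  "Nuni m = {A \<in> carrier_mat m m. \<forall>i<m. \<forall>j<m.
      (j < i \<longrightarrow> A $$ (i,j) = 0) \<and> (i = j \<longrightarrow> A $$ (i,j) = 1)}"

definition psiN :: "('k::field \<Rightarrow> 'r::comm_ring_1) \<Rightarrow> nat \<Rightarrow> 'k mat \<Rightarrow> 'r" where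
  "psiN chr m A = chr (\<Sum>i<m - 1. A $$ (i, i + 1))"

text \<open>Unipotent radical U_m of the mirabolic P_m: identity except last column above the diagonal.
  On it psiN restricts to y \<mapsto> chr(y_{m-1}).\<close>
definition Umir :: "nat \<Rightarrow> 'k::field mat set" where
  "Umir m = {A \<in> carrier_mat m m. \<forall>i<m. \<forall>j<m.
      (j \<noteq> m - 1 \<or> i = m - 1) \<longrightarrow> A $$ (i,j) = (if i = j then 1 else 0)}"

text \<open>Kernel of V \<rightarrow> (Phi^-)^j(V), for V a representation (carrier Vs) of P_n (or G_n),
  with respect to the additive character chr.  The P_{n-j}-action on the quotient is via emb.\<close>
fun phi_ker :: "('r::comm_ring_1 \<Rightarrow> 'v::ab_group_add \<Rightarrow> 'v) \<Rightarrow> ('k::field mat \<Rightarrow> 'v \<Rightarrow> 'v)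
     \<Rightarrow> 'v set \<Rightarrow> ('k \<Rightarrow> 'r) \<Rightarrow> nat \<Rightarrow> nat \<Rightarrow> 'v set" where
  "phi_ker sc act Vs chr n 0 = {0}"
| "phi_ker sc act Vs chr n (Suc j) = Modules.module.span sc (phi_ker sc act Vs chr n j \<union>
     {act (emb n (n - j) u) v - sc (psiN chr (n - j) u) v | u v. u \<in> Umir (n - j) \<and> v \<in> Vs})"

text \<open>Kernel of V \<rightarrow> V^{(k)} = Psi^-(Phi^-)^{k-1}(V); V^{(0)} = V.\<close>
definition deriv_ker :: "('r::comm_ring_1 \<Rightarrow> 'v::ab_group_add \<Rightarrow> 'v) \<Rightarrow> ('k::field mat \<Rightarrow> 'v \<Rightarrow> 'v)
     \<Rightarrow> 'v set \<Rightarrow> ('k \<Rightarrow> 'r) \<Rightarrow> nat \<Rightarrow> nat \<Rightarrow> 'v set" where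
  "deriv_ker sc act Vs chr n k = (if k = 0 then {0} else
     Modules.module.span sc (phi_ker sc act Vs chr n (k - 1) \<union>
       {act (emb n (n - (k - 1)) u) v - v | u v. u \<in> Umir (n - (k - 1)) \<and> v \<in> Vs}))"

definition is_Gn_rep :: "('r::comm_ring_1 \<Rightarrow> 'v::ab_group_add \<Rightarrow> 'v) \<Rightarrow> ('k::field mat \<Rightarrow> 'v \<Rightarrow> 'v)
     \<Rightarrow> nat \<Rightarrow> bool" where
  "is_Gn_rep sc act n \<longleftrightarrow> Modules.module sc \<and> (\<forall>g\<in>GL n. Modules.module_hom sc sc (act g))
     \<and> act (1\<^sub>m n) = id \<and> (\<forall>g\<in>GL n. \<forall>h\<in>GL n. act (g * h) = act g \<circ> act h)"

text \<open>lam is an R-linear isomorphism V^{(n)} \<rightarrow> R (i.e. a generator of Hom_R(V^{(n)},R) when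
  V^{(n)} is free of rank one), written as a surjective linear map V \<rightarrow> R with kernel the
  kernel of V \<rightarrow> V^{(n)}.\<close>
definition whitt_functional :: "('r::comm_ring_1 \<Rightarrow> 'v::ab_group_add \<Rightarrow> 'v) \<Rightarrow> ('k::field mat \<Rightarrow> 'v \<Rightarrow> 'v)
     \<Rightarrow> ('k \<Rightarrow> 'r) \<Rightarrow> nat \<Rightarrow> ('v \<Rightarrow> 'r) \<Rightarrow> bool" where
  "whitt_functional sc act chr n lam \<longleftrightarrow> Modules.module_hom sc (*) lam \<and> surj lam
     \<and> {v. lam v = 0} = deriv_ker sc act UNIV chr n n"

definition whitt_model :: "('k::field mat \<Rightarrow> 'v \<Rightarrow> 'v) \<Rightarrow> nat \<Rightarrow> ('v \<Rightarrow> 'r::comm_ring_1)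
     \<Rightarrow> ('k mat \<Rightarrow> 'r) set" where
  "whitt_model act n lam = {f. \<exists>v. f = (\<lambda>g. if g \<in> GL n then lam (act g v) else 0)}"

definition fscale :: "'r::comm_ring_1 \<Rightarrow> ('a \<Rightarrow> 'r) \<Rightarrow> ('a \<Rightarrow> 'r)" where
  "fscale r f = (\<lambda>x. r * f x)"

definition rt :: "nat \<Rightarrow> 'k::field mat \<Rightarrow> ('k mat \<Rightarrow> 'r::comm_ring_1) \<Rightarrow> ('k mat \<Rightarrow> 'r)" where
  "rt n g f = (\<lambda>x. if x \<in> GL n then f (x * g) else 0)"

definition bilinear_on :: "('a \<Rightarrow> 'r::comm_ring_1) set \<Rightarrow> ('b \<Rightarrow> 'r) set \<Rightarrow> (('a \<Rightarrow> 'r) \<Rightarrow> ('b \<Rightarrow> 'r) \<Rightarrow> 'r) \<Rightarrow> bool" where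
  "bilinear_on A B F \<longleftrightarrow>
     (\<forall>x1\<in>A. \<forall>x2\<in>A. \<forall>y\<in>B. F (x1 + x2) y = F x1 y + F x2 y) \<and>
     (\<forall>r. \<forall>x\<in>A. \<forall>y\<in>B. F (fscale r x) y = r * F x y) \<and>
     (\<forall>x\<in>A. \<forall>y1\<in>B. \<forall>y2\<in>B. F x (y1 + y2) = F x y1 + F x y2) \<and>
     (\<forall>r. \<forall>x\<in>A. \<forall>y\<in>B. F x (fscale r y) = r * F x y)"

text \<open>pi' exceptional for pi, in terms of the Whittaker models W (of G_n, w.r.t. psi) and
  W' (of G_m, w.r.t. psi^{-1}): a nonzero G_t-invariant bilinear form on W^{(n-t)} x W'^{(m-t)},
  written as a bilinear form on W x W' vanishing on the kernels of the quotient maps.\<close>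
definition exceptional :: "('k::field \<Rightarrow> 'r::comm_ring_1) \<Rightarrow> nat \<Rightarrow> nat
     \<Rightarrow> ('k mat \<Rightarrow> 'r) set \<Rightarrow> ('k mat \<Rightarrow> 'r) set \<Rightarrow> bool" where
  "exceptional psi n m W W' \<longleftrightarrow> (\<exists>t\<in>{1..m}. \<exists>F. bilinear_on W W' F
     \<and> (\<forall>x\<in>deriv_ker fscale (rt n) W psi n (n - t). \<forall>y\<in>W'. F x y = 0)
     \<and> (\<forall>x\<in>W. \<forall>y\<in>deriv_ker fscale (rt m) W' (\<lambda>a. psi (- a)) m (m - t). F x y = 0)
     \<and> (\<forall>g\<in>GL t. \<forall>x\<in>W. \<forall>y\<in>W'. F (rt n (emb n t g) x) (rt m (emb m t g) y) = F x y)
     \<and> (\<exists>x\<in>W. \<exists>y\<in>W'. F x y \<noteq> 0))"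

text \<open>U_{n,n-m-1}: matrices (I_{m+1} z; 0 y) with y upper unitriangular.\<close>
definition Uhn :: "nat \<Rightarrow> nat \<Rightarrow> 'k::field mat set" where
  "Uhn n m = {A \<in> carrier_mat n n. \<forall>i<n. \<forall>j<n.
      (j \<le> m \<longrightarrow> A $$ (i,j) = (if i = j then 1 else 0)) \<and>
      (m < i \<longrightarrow> j \<le> i \<longrightarrow> A $$ (i,j) = (if i = j then 1 else 0))}"

text \<open>(H,chi)-equivariant bilinear forms on W x W', H = G_m U_{n,n-m-1}; every h in H is
  uniquely g u, acting on W by right translation by h and on W' by right translation by g.\<close>
definition H_equivariant :: "('k::field \<Rightarrow> 'r::comm_ring_1) \<Rightarrow> nat \<Rightarrow> nat
     \<Rightarrow> ('k mat \<Rightarrow> 'r) set \<Rightarrow> ('k mat \<Rightarrow> 'r) set \<Rightarrow> (('k mat \<Rightarrow> 'r) \<Rightarrow> ('k mat \<Rightarrow> 'r) \<Rightarrow> 'r) \<Rightarrow> bool" where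
  "H_equivariant psi n m W W' F \<longleftrightarrow> bilinear_on W W' F \<and>
     (\<forall>g\<in>GL m. \<forall>u\<in>Uhn n m. \<forall>x\<in>W. \<forall>y\<in>W'.
        F (rt n (emb n m g * u) x) (rt m g y) = psiN psi n u * F x y)"

definition rs_integral :: "nat \<Rightarrow> nat \<Rightarrow> ('k::field mat \<Rightarrow> 'r::comm_ring_1) \<Rightarrow> ('k mat \<Rightarrow> 'r) \<Rightarrow> 'r" where
  "rs_integral n m W W' = (\<Sum>C \<in> (\<lambda>g. {u * g | u. u \<in> Nuni m}) ` GL m.
      W (emb n m (SOME g. g \<in> C)) * W' (SOME g. g \<in> C))"

definition noetherian :: "'r::comm_ring_1 itself \<Rightarrow> bool" where
  "noetherian _ \<longleftrightarrow> (\<forall>I::'r set. Modules.module.subspace (*) I \<longrightarrow>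
      (\<exists>F. finite F \<and> F \<subseteq> I \<and> Modules.module.span (*) F = I))"

end

theory Submission
  imports Defs "Jordan_Normal_Form.Determinant" "HOL-Number_Theory.Cong" "HOL-Library.Cardinality"
begin

text \<open>Since \<open>q\<close> is invertible in the coefficient ring, twisted coinvariants of the unipotent groups
  \<open>U_s\<close> are images of averaging projectors. Let \<open>Q_j\<close> and \<open>Q'_j\<close> be the products of the projectors
  of \<open>U_s\<close>, \<open>s > j\<close>, for \<open>psi\<close> on \<open>W\<close> and for its inverse on \<open>W'\<close>, and let \<open>F\<close> be an equivariant form.
  Fourier expansion along \<open>U_j\<close> splits \<open>F (Q_j x) (Q'_j y)\<close> over pairs of characters of \<open>U_j\<close>. Only
  mutually inverse pairs contribute; the trivial pair vanishes because the representations are not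
  exceptional, and a nontrivial pair is moved by \<open>GL_(j-1)\<close> to the pair given by \<open>psi\<close> and its inverse,
  which is the same expression with \<open>j - 1\<close> for \<open>j\<close>. Descending to \<open>j = 1\<close>, an equivariant form that
  vanishes on all pairs \<open>(Q_1 x, Q'_1 y)\<close> is zero.

  By uniqueness of the Whittaker functional, \<open>Q_1 x\<close> is determined by the value \<open>x 1\<close>. As \<open>Q_1 x\<close>
  is equivariant on both sides, its restriction to \<open>GL_m\<close>, \<open>m < n\<close>, is supported on the unipotent
  subgroup, so the Rankin-Selberg sum of \<open>Q_1 x\<close> and \<open>Q'_1 y\<close> is \<open>x 1 * y 1\<close>. Subtracting the right
  multiple of the sum from \<open>F\<close> therefore gives zero.\<close>

section \<open>The order of a finite field\<close>

text \<open>Take an additive subset S of p-power order of maximal size. If \<open>a\<close> were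
  missing from S, the sums s + i a with s in S and i < p would be pairwise distinct and closed under
  addition, giving such a subset p times as large.\<close>

lemma card_finite_field_CHAR_power:
  "\<exists>e. card (UNIV :: 'k::{field,finite} set) = CHAR('k) ^ e"
proof -
  define p where "p = CHAR('k)"
  have p0: "p > 0" unfolding p_def by (rule finite_imp_CHAR_pos) simp
  have p: "prime p" using p0 prime_CHAR_semidom[where 'a='k] unfolding p_def by simp
  have ofp: "of_nat p = (0::'k)" by (simp add: p_def)
  define P where "P = (\<lambda>S::'k set. 0 \<in> S \<and> (\<forall>a\<in>S. \<forall>b\<in>S. a + b \<in> S) \<and> (\<exists>e. card S = p ^ e))"
  have "P {0}" unfolding P_def by (auto intro: exI[of _ 0])
  moreover have "\<forall>S. P S \<longrightarrow> card S \<le> CARD('k)" by (simp add: card_mono)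
  ultimately obtain S where S: "P S" and max: "\<And>T. P T \<Longrightarrow> card T \<le> card S"
    using ex_has_greatest_nat[of P "{0}" card "Suc CARD('k)"] less_Suc_eq_le by metis
  have S0: "0 \<in> S" and Sadd: "\<And>a b. a \<in> S \<Longrightarrow> b \<in> S \<Longrightarrow> a + b \<in> S" using S by (auto simp: P_def)
  obtain e where e: "card S = p ^ e" using S by (auto simp: P_def)
  have Smul: "of_nat i * a \<in> S" if "a \<in> S" for i a
    by (induction i) (use that S0 Sadd in \<open>auto simp: algebra_simps\<close>)
  have Sdiff: "a - b \<in> S" if "a \<in> S" "b \<in> S" for a b
  proof -
    \<comment> \<open>In characteristic p, adding p - 1 copies of b subtracts b.\<close>
    have "a + of_nat (p - 1) * b \<in> S" using that Sadd Smul by blast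
    thus ?thesis using p0 ofp by (simp add: of_nat_diff algebra_simps)
  qed
  have "S = UNIV"
  proof (rule ccontr)
    assume "S \<noteq> UNIV"
    then obtain a where a: "a \<notin> S" by auto
    let ?f = "\<lambda>(s, i). s + of_nat i * a"
    \<comment> \<open>A collision with i < j puts (j - i) a in S; multiplying by an inverse of j - i
      modulo p then puts \<open>a\<close> itself in S.\<close>
    have aux: "\<not> i < j" if "s + of_nat i * a = s' + of_nat j * a" "s \<in> S" "s' \<in> S" "j < p" for s s' i j
    proof
      assume ij: "i < j"
      hence "of_nat (j - i) * a = s - s'" using that by (simp add: of_nat_diff algebra_simps)
      hence in_S: "of_nat (j - i) * a \<in> S" using that Sdiff by simp
      have "coprime p (j - i)"
        using p that(4) ij by (intro prime_imp_coprime) (auto dest: dvd_imp_le)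
      hence "coprime (j - i) p" by (simp add: coprime_commute)
      then obtain c where c: "[(j - i) * c = Suc 0] (mod p)" using cong_solve_coprime_nat by blast
      hence "of_nat ((j - i) * c) = (of_nat (Suc 0) :: 'k)"
        using of_nat_eq_iff_cong_CHAR p_def by blast
      hence "of_nat c * (of_nat (j - i) * a) = a"
        by (metis mult.assoc mult.commute mult.left_neutral of_nat_1 of_nat_mult One_nat_def)
      thus False using Smul[OF in_S, of c] a by (simp only:)
    qed
    have inj: "inj_on ?f (S \<times> {..<p})"
    proof (rule inj_onI, clarsimp)
      fix s i s' j assume h: "s \<in> S" "s' \<in> S" "i < p" "j < p" "s + of_nat i * a = s' + of_nat j * a"
      have "i = j" using aux[of s i s' j] aux[of s' j s i] h by auto
      thus "s = s' \<and> i = j" using h by auto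
    qed
    have "P (?f ` (S \<times> {..<p}))"
      unfolding P_def
    proof (intro conjI ballI)
      show "0 \<in> ?f ` (S \<times> {..<p})" using S0 p0 by (auto intro!: image_eqI[of _ _ "(0,0)"])
      fix x y assume "x \<in> ?f ` (S \<times> {..<p})" "y \<in> ?f ` (S \<times> {..<p})"
      then obtain s i s' j where h: "s \<in> S" "s' \<in> S" "x = s + of_nat i * a" "y = s' + of_nat j * a" by auto
      have "of_nat ((i + j) mod p) = (of_nat (i + j) :: 'k)"
        unfolding p_def by (subst of_nat_eq_iff_cong_CHAR) (simp add: cong_def)
      hence "x + y = ?f (s + s', (i + j) mod p)" using h by (simp add: algebra_simps)
      moreover have "(s + s', (i + j) mod p) \<in> S \<times> {..<p}" using h Sadd p0 by simp
      ultimately show "x + y \<in> ?f ` (S \<times> {..<p})" by (rule image_eqI)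
    next
      have "card (?f ` (S \<times> {..<p})) = p ^ Suc e"
        using e by (simp add: card_image[OF inj] card_cartesian_product)
      thus "\<exists>e. card (?f ` (S \<times> {..<p})) = p ^ e" by blast
    qed
    from max[OF this] have "p ^ e * p \<le> p ^ e"
      using e by (simp add: card_image[OF inj] card_cartesian_product)
    thus False using prime_gt_1_nat[OF p] by simp
  qed
  thus ?thesis using e by (auto simp: p_def)
qed

section \<open>Counting vectors and matrices over a finite type\<close>

lemma carrier_vec_eq_image_PiE: "(carrier_vec d :: 'a vec set) = vec d ` PiE {..<d} (\<lambda>_. UNIV)"
proof (intro subset_antisym subsetI)
  fix v :: "'a vec" assume "v \<in> carrier_vec d"
  hence "v = vec d (\<lambda>i\<in>{..<d}. v $ i)" by (intro eq_vecI) auto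
  thus "v \<in> vec d ` PiE {..<d} (\<lambda>_. UNIV)"
    by (rule image_eqI[where f = "vec d"]) (simp add: restrict_PiE_iff)
qed (elim imageE, simp)

lemma finite_carrier_vec [simp]: "finite (carrier_vec d :: 'a::finite vec set)"
  unfolding carrier_vec_eq_image_PiE by (intro finite_imageI finite_PiE) auto

lemma card_carrier_vec: "card (carrier_vec d :: 'a::finite vec set) = CARD('a) ^ d"
proof -
  have "inj_on (vec d) (PiE {..<d} (\<lambda>_. UNIV :: 'a set))"
    by (intro inj_onI) (auto simp: vec_eq_iff intro: PiE_ext)
  thus ?thesis unfolding carrier_vec_eq_image_PiE by (simp add: card_image card_PiE)
qed

lemma finite_carrier_mat [simp]: "finite (carrier_mat a b :: 'a::finite mat set)"
proof (rule finite_subset)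
  show "carrier_mat a b \<subseteq> mat a b ` PiE ({..<a} \<times> {..<b}) (\<lambda>_. UNIV :: 'a set)"
  proof
    fix A :: "'a mat" assume "A \<in> carrier_mat a b"
    hence "A = mat a b (\<lambda>x\<in>{..<a} \<times> {..<b}. A $$ x)" by (intro eq_matI) auto
    thus "A \<in> mat a b ` PiE ({..<a} \<times> {..<b}) (\<lambda>_. UNIV)"
      by (rule image_eqI[where f = "mat a b"]) (simp add: restrict_PiE_iff)
  qed
qed (intro finite_imageI finite_PiE; auto)

section \<open>Additive characters and their orthogonality\<close>

text \<open>The ring may have zero divisors, so nontriviality of psi is recorded as the vanishing of
  its sum. The axioms are stable under inverting psi, so each result applies both to
  \<open>W\<close> and to \<open>W'\<close>.\<close>

locale additive_character =
  fixes psi :: "'k::{field,finite} \<Rightarrow> 'r::comm_ring_1"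
  assumes psi_add: "psi (a + b) = psi a * psi b"
    and psi_0 [simp]: "psi 0 = 1"
    and psi_sum: "(\<Sum>a\<in>UNIV. psi a) = 0"
    and card_unit: "\<exists>x::'r. of_nat CARD('k) * x = 1"
begin

lemma psi_minus: "psi a * psi (- a) = 1"
  by (simp flip: psi_add)

lemma psi_sum_mult: "c \<noteq> 0 \<Longrightarrow> (\<Sum>a\<in>UNIV. psi (a * c)) = 0"
  using psi_sum sum.reindex_bij_witness[of UNIV "\<lambda>a. a / c" "\<lambda>a. a * c" UNIV psi "\<lambda>a. psi (a * c)"]
  by simp

lemma card_mult_cancel: "of_nat CARD('k) * (x::'r) = 0 \<Longrightarrow> x = 0"
  using card_unit by (metis mult.commute mult.left_commute mult_1 mult_zero_right)

lemma inverse_character: "additive_character (\<lambda>a. psi (- a))"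
proof
  have "(\<Sum>a\<in>UNIV. psi (- a)) = (\<Sum>a\<in>UNIV. psi a)"
    by (rule sum.reindex_bij_witness[of _ uminus uminus]) auto
  thus "(\<Sum>a\<in>UNIV. psi (- a)) = 0" using psi_sum by simp
  show "psi (- (a + b)) = psi (- a) * psi (- b)" for a b
    using psi_add[of "- a" "- b"] by simp
qed (use card_unit in auto)

text \<open>If c_i is nonzero, translating y by a times the i-th basis vector multiplies the sum S
  by psi (a c_i). Summing over all a gives q S = 0, and q is invertible.\<close>

lemma psi_sum_scalar_prod:
  assumes c: "c \<in> carrier_vec d"
  shows "(\<Sum>y\<in>carrier_vec d. psi (c \<bullet> y)) = (if c = 0\<^sub>v d then of_nat (CARD('k) ^ d) else 0)"
proof (cases "c = 0\<^sub>v d")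
  case True
  thus ?thesis by (simp add: card_carrier_vec)
next
  case False
  then obtain i where i: "i < d" "c $ i \<noteq> 0" using c by (auto simp: vec_eq_iff)
  let ?S = "\<Sum>y\<in>carrier_vec d. psi (c \<bullet> y)"
  have sh: "psi (a * c $ i) * ?S = ?S" for a
  proof -
    let ?e = "a \<cdot>\<^sub>v unit_vec d i"
    have "?S = (\<Sum>y\<in>carrier_vec d. psi (c \<bullet> (y + ?e)))"
    proof (rule sum.reindex_bij_witness[of _ "\<lambda>y. y + ?e" "\<lambda>y. y - ?e"])
      fix y :: "'k vec" assume "y \<in> carrier_vec d"
      thus "y - ?e + ?e = y" "y + ?e - ?e = y" by (auto simp: vec_eq_iff)
      thus "psi (c \<bullet> (y - ?e + ?e)) = psi (c \<bullet> y)" by simp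
    qed auto
    also have "\<dots> = (\<Sum>y\<in>carrier_vec d. psi (a * c $ i) * psi (c \<bullet> y))"
      using c i by (intro sum.cong) (auto simp: scalar_prod_add_distrib[of _ d] psi_add mult.commute)
    finally show ?thesis by (metis sum_distrib_left)
  qed
  have "of_nat CARD('k) * ?S = (\<Sum>a\<in>UNIV. psi (a * c $ i) * ?S)" by (simp add: sh)
  also have "\<dots> = 0" using psi_sum_mult[OF i(2)] by (simp flip: sum_distrib_right)
  finally show ?thesis using card_mult_cancel False by auto
qed

definition card_inv :: "nat \<Rightarrow> 'r" where
  "card_inv d = (SOME x. of_nat CARD('k) * x = 1) ^ d"

lemma card_inv: "of_nat (CARD('k) ^ d) * card_inv d = 1" "card_inv d * of_nat (CARD('k) ^ d) = 1"
  "of_nat CARD('k) ^ d * card_inv d = 1" "card_inv d * of_nat CARD('k) ^ d = 1"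
proof -
  have "of_nat CARD('k) * (SOME x::'r. of_nat CARD('k) * x = 1) = 1"
    by (rule someI_ex[OF card_unit])
  thus "of_nat CARD('k) ^ d * card_inv d = 1"
    unfolding card_inv_def power_mult_distrib[symmetric] by simp
  thus "of_nat (CARD('k) ^ d) * card_inv d = 1" "card_inv d * of_nat (CARD('k) ^ d) = 1"
  "card_inv d * of_nat CARD('k) ^ d = 1"
    by (simp_all add: mult.commute)
qed

text \<open>Sum the hypothesis over all y: the character sums to zero, and the number q^d of vectors
  is invertible. Both comparisons of distinct characters below, on values and on forms, end with
  this.\<close>

lemma eq_0_if_twisted:
  assumes c: "c \<in> carrier_vec d" "c \<noteq> 0\<^sub>v d" and X: "\<And>y. y \<in> carrier_vec d \<Longrightarrow> X = psi (c \<bullet> y) * X"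
  shows "X = 0"
proof -
  have "of_nat (CARD('k) ^ d) * X = (\<Sum>y\<in>(carrier_vec d :: 'k vec set). X)"
    by (simp add: card_carrier_vec)
  also have "\<dots> = (\<Sum>y\<in>carrier_vec d. psi (c \<bullet> y) * X)" using X by (intro sum.cong) auto
  also have "\<dots> = 0" using psi_sum_scalar_prod[OF c(1)] c(2) by (simp flip: sum_distrib_right)
  finally have "card_inv d * (of_nat (CARD('k) ^ d) * X) = 0" by simp
  thus ?thesis using card_inv(2)[of d] by (metis mult.assoc mult_1)
qed

end

text \<open>\<open>zeta_cyclo\<close> makes zeta a root of the p-th cyclotomic polynomial, and
  \<open>tr\<close> is an additive map to the integers mod p written by representatives. If tr b =
  1, translation by b shows zeta S = S for the sum S of all values, so p S = (1 + zeta + ... +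
  zeta^(p-1)) S = 0.\<close>

lemma additive_character_root_of_unity:
  fixes zeta :: "'r::comm_ring_1" and tr :: "'k::{field,finite} \<Rightarrow> nat"
  assumes p_unit: "\<exists>x::'r. of_nat CHAR('k) * x = 1"
    and zeta_cyclo: "(\<Sum>i<CHAR('k). zeta ^ i) = 0"
    and tr_range: "\<forall>a. tr a < CHAR('k)"
    and tr_add: "\<forall>a b. tr (a + b) = (tr a + tr b) mod CHAR('k)"
    and tr_nontriv: "\<exists>a. tr a \<noteq> 0"
  shows "additive_character (\<lambda>a. zeta ^ tr a)"
proof -
  define p where "p = CHAR('k)"
  have p0: "p > 0" unfolding p_def by (rule finite_imp_CHAR_pos) simp
  have p: "prime p" using p0 prime_CHAR_semidom[where 'a='k] unfolding p_def by simp
  obtain pinv :: 'r where pinv: "of_nat p * pinv = 1" using p_unit p_def by auto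
  have zp: "zeta ^ p = 1"
  proof -
    have "(zeta - 1) * (\<Sum>i<p. zeta ^ i) = zeta ^ p - 1" by (simp add: power_diff_1_eq)
    thus ?thesis using zeta_cyclo by (simp add: p_def)
  qed
  have zmod: "zeta ^ (k mod p) = zeta ^ k" for k
  proof -
    have "zeta ^ k = zeta ^ (p * (k div p) + k mod p)" by (simp only: mult_div_mod_eq)
    also have "\<dots> = zeta ^ (k mod p)" unfolding power_add power_mult zp by simp
    finally show ?thesis by (rule sym)
  qed
  have tr0: "tr 0 = 0"
  proof -
    have lt: "tr 0 < p" using tr_range p_def by simp
    have "tr (0 + 0) = (tr 0 + tr 0) mod p" using tr_add p_def by blast
    hence "[tr 0 + tr 0 = tr 0] (mod p)" using lt by (simp add: cong_def)
    hence "p dvd tr 0" by (simp add: cong_add_lcancel_0_nat cong_0_iff)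
    thus ?thesis using lt nat_dvd_not_less by blast
  qed
  have add: "zeta ^ tr (a + b) = zeta ^ tr a * zeta ^ tr b" for a b
    using tr_add zmod by (simp add: p_def power_add)
  obtain a where a: "tr a \<noteq> 0" using tr_nontriv by auto
  have trm: "tr (of_nat i * a) = (i * tr a) mod p" for i
  proof (induction i)
    case (Suc i)
    have "tr (of_nat (Suc i) * a) = (tr a + tr (of_nat i * a)) mod p"
      using tr_add by (simp add: algebra_simps p_def)
    thus ?case using Suc by (simp add: mod_simps)
  qed (simp add: tr0)
  \<comment> \<open>The nonzero residue \<open>tr a\<close> is invertible mod p, so
    \<open>tr\<close> takes the value 1 on some multiple of \<open>a\<close>.\<close>
  have "tr a < p" using tr_range p_def by simp
  hence "coprime p (tr a)" using p a by (intro prime_imp_coprime) (auto dest: dvd_imp_le)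
  hence "coprime (tr a) p" by (simp add: coprime_commute)
  then obtain c where "[tr a * c = Suc 0] (mod p)" using cong_solve_coprime_nat by blast
  hence "tr (of_nat c * a) = 1"
    using trm prime_gt_1_nat[OF p] by (simp add: cong_def mult.commute)
  then obtain b where b: "tr b = 1" by blast
  let ?S = "\<Sum>a\<in>(UNIV::'k set). zeta ^ tr a"
  have "?S = (\<Sum>a\<in>(UNIV::'k set). zeta ^ tr (b + a))"
    by (rule sum.reindex_bij_witness[of _ "\<lambda>y. b + y" "\<lambda>y. y - b"]) auto
  also have "\<dots> = zeta * ?S" using b by (simp add: add sum_distrib_left)
  finally have z1: "zeta * ?S = ?S" by (rule sym)
  have zi: "zeta ^ i * ?S = ?S" for i
    by (induction i) (use z1 in \<open>auto simp: mult.assoc\<close>)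
  have "of_nat p * ?S = (\<Sum>i<p. zeta ^ i * ?S)" by (simp add: zi)
  also have "\<dots> = 0" using zeta_cyclo by (simp add: p_def flip: sum_distrib_right)
  finally have S: "?S = 0" using pinv by (metis mult.commute mult.left_commute mult_1 mult_zero_right)
  obtain e where "CARD('k) = p ^ e" using card_finite_field_CHAR_power p_def by blast
  hence "of_nat CARD('k) * pinv ^ e = (of_nat p * pinv) ^ e" by (simp add: power_mult_distrib)
  hence "\<exists>x::'r. of_nat CARD('k) * x = 1" using pinv by auto
  thus ?thesis using add S tr0 by unfold_locales auto
qed

section \<open>General linear groups and the corner embedding\<close>

lemma GL_iff_det: "A \<in> GL n \<longleftrightarrow> A \<in> carrier_mat n n \<and> det A \<noteq> 0"
proof
  assume "A \<in> GL n"
  hence A: "A \<in> carrier_mat n n" and "invertible_mat A" by (auto simp: GL_def)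
  then obtain B where B: "A * B = 1\<^sub>m n" "B * A = 1\<^sub>m (dim_row B)"
    by (auto simp: invertible_mat_def inverts_mat_def)
  have "dim_row (B * A) = dim_row B" "dim_col (B * A) = n" "dim_col (A * B) = dim_col B"
    using A by auto
  hence Bc: "B \<in> carrier_mat n n" using B by (intro carrier_matI) auto
  have "det A * det B = 1" using det_mult[OF A Bc] B(1) by simp
  thus "A \<in> carrier_mat n n \<and> det A \<noteq> 0" using A by auto
next
  assume A: "A \<in> carrier_mat n n \<and> det A \<noteq> 0"
  then obtain B where B: "B \<in> carrier_mat n n" "A * B = 1\<^sub>m n"
    using det_non_zero_imp_unit[of A n "()"]
    by (auto simp: Units_def ring_mat_def)
  have "B * A = 1\<^sub>m n" using mat_mult_left_right_inverse B A by blast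
  thus "A \<in> GL n" using A B by (auto simp: GL_def invertible_mat_def inverts_mat_def)
qed

lemma GL_carrier: "A \<in> GL n \<Longrightarrow> A \<in> carrier_mat n n"
  by (simp add: GL_def)

lemma GL_one [simp]: "1\<^sub>m n \<in> GL n"
  by (simp add: GL_iff_det)

lemma GL_mult [simp]: "A \<in> GL n \<Longrightarrow> B \<in> GL n \<Longrightarrow> A * B \<in> GL n"
  by (auto simp: GL_iff_det det_mult)

lemma GL_left_right_inverse:
  assumes "A \<in> carrier_mat n n" "B \<in> carrier_mat n n" "A * B = 1\<^sub>m n"
  shows "A \<in> GL n" "B \<in> GL n"
proof -
  have "det A * det B = 1" using det_mult[OF assms(1,2)] assms(3) by simp
  thus "A \<in> GL n" "B \<in> GL n" using assms by (auto simp: GL_iff_det)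
qed

lemma GL_inverse:
  assumes "A \<in> GL n"
  obtains B where "B \<in> GL n" "A * B = 1\<^sub>m n" "B * A = 1\<^sub>m n"
proof -
  have A: "A \<in> carrier_mat n n" "det A \<noteq> 0" using assms by (auto simp: GL_iff_det)
  then obtain B where B: "B \<in> carrier_mat n n" "A * B = 1\<^sub>m n"
    using det_non_zero_imp_unit[of A n "()"] by (auto simp: Units_def ring_mat_def)
  thus thesis using that mat_mult_left_right_inverse[OF A(1) B] GL_left_right_inverse[OF A(1) B] by blast
qed

lemma finite_GL [simp]: "finite (GL n :: 'k::{field,finite} mat set)"
  by (rule finite_subset[OF _ finite_carrier_mat[of n n]]) (auto simp: GL_carrier)

lemma emb_carrier [simp]: "m \<le> n \<Longrightarrow> A \<in> carrier_mat m m \<Longrightarrow> emb n m A \<in> carrier_mat n n"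
  unfolding emb_def using four_block_carrier_mat[of A m m "1\<^sub>m (n - m)" "n - m" "n - m"] by simp

lemma emb_index:
  assumes "m \<le> n" "A \<in> carrier_mat m m" "i < n" "j < n"
  shows "emb n m A $$ (i, j) = (if i < m \<and> j < m then A $$ (i, j) else if i = j then 1 else 0)"
  using assms unfolding emb_def by auto

lemma emb_mult:
  assumes "m \<le> n" "A \<in> carrier_mat m m" "B \<in> carrier_mat m m"
  shows "emb n m (A * B) = emb n m A * emb n m B"
proof -
  have "emb n m A * emb n m B =
    four_block_mat (A * B + 0\<^sub>m m (n - m) * 0\<^sub>m (n - m) m) (A * 0\<^sub>m m (n - m) + 0\<^sub>m m (n - m) * 1\<^sub>m (n - m))
     (0\<^sub>m (n - m) m * B + 1\<^sub>m (n - m) * 0\<^sub>m (n - m) m) (0\<^sub>m (n - m) m * 0\<^sub>m m (n - m) + 1\<^sub>m (n - m) * 1\<^sub>m (n - m))"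
    unfolding emb_def by (rule mult_four_block_mat) (use assms in auto)
  also have "\<dots> = emb n m (A * B)"
    unfolding emb_def using assms by auto
  finally show ?thesis by (rule sym)
qed

lemma emb_one [simp]: "m \<le> n \<Longrightarrow> emb n m (1\<^sub>m m) = 1\<^sub>m n"
  unfolding emb_def by simp

lemma emb_self [simp]: "A \<in> carrier_mat n n \<Longrightarrow> emb n n A = A"
  by (rule eq_matI) (auto simp: emb_index carrier_matD[OF emb_carrier[OF le_refl]])

lemma emb_emb:
  assumes "l \<le> m" "m \<le> n" "A \<in> carrier_mat l l"
  shows "emb n m (emb m l A) = emb n l A"
proof (rule eq_matI)
  have c: "emb n m (emb m l A) \<in> carrier_mat n n" "emb n l A \<in> carrier_mat n n" "emb m l A \<in> carrier_mat m m"
    using assms by auto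
  thus "dim_row (emb n m (emb m l A)) = dim_row (emb n l A)" "dim_col (emb n m (emb m l A)) = dim_col (emb n l A)"
    by auto
  fix i j assume "i < dim_row (emb n l A)" "j < dim_col (emb n l A)"
  hence "i < n" "j < n" using c by auto
  thus "emb n m (emb m l A) $$ (i, j) = emb n l A $$ (i, j)"
    using assms c by (simp add: emb_index)
qed

lemma det_emb: "m \<le> n \<Longrightarrow> A \<in> carrier_mat m m \<Longrightarrow> det (emb n m A) = det A"
  unfolding emb_def by (subst det_four_block_mat_upper_right_zero[of _ m _ "n - m"]) auto

lemma emb_GL_iff: "m \<le> n \<Longrightarrow> A \<in> carrier_mat m m \<Longrightarrow> emb n m A \<in> GL n \<longleftrightarrow> A \<in> GL m"
  by (simp add: GL_iff_det det_emb)

lemma emb_GL [simp]: "m \<le> n \<Longrightarrow> A \<in> GL m \<Longrightarrow> emb n m A \<in> GL n"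
  by (simp add: emb_GL_iff GL_carrier)

section \<open>Unipotent radicals of the mirabolic subgroups\<close>

text \<open>This identifies U_s with the additive group of column vectors of length s - 1, so that
  its characters become y -> psi (c . y).\<close>

definition umat :: "nat \<Rightarrow> 'k::field vec \<Rightarrow> 'k mat" where
  "umat s y = four_block_mat (1\<^sub>m (s - 1)) (mat (s - 1) 1 (\<lambda>(i, _). y $ i)) (0\<^sub>m 1 (s - 1)) (1\<^sub>m 1)"

text \<open>The vector c for which y -> psi (c . y) is psi on U_(d+1). In dimension 0 it is the
  empty vector, which fits the trivial group U_1.\<close>

definition lastv :: "nat \<Rightarrow> 'k::field vec" where
  "lastv d = unit_vec d (d - 1)"

lemma lastv_carrier [simp]: "lastv d \<in> carrier_vec d"
  by (simp add: lastv_def)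

lemma dim_lastv [simp]: "dim_vec (lastv d) = d"
  by (simp add: lastv_def)

lemma umat_carrier [simp]: "0 < s \<Longrightarrow> umat s y \<in> carrier_mat s s"
  unfolding umat_def using four_block_carrier_mat[of "1\<^sub>m (s - 1)" "s - 1" "s - 1" "1\<^sub>m 1" 1 1] by simp

lemma umat_index:
  assumes "i < s" "j < s"
  shows "umat s y $$ (i, j) = (if i = j then 1 else if j = s - 1 then y $ i else 0)"
  using assms unfolding umat_def by auto

lemma umat_mult:
  assumes "0 < s" "y \<in> carrier_vec (s - 1)" "z \<in> carrier_vec (s - 1)"
  shows "umat s y * umat s z = umat s (y + z)"
proof -
  let ?c = "\<lambda>y. mat (s - 1) 1 (\<lambda>(i, _). y $ i)"
  have "umat s y * umat s z = four_block_mat (1\<^sub>m (s - 1) * 1\<^sub>m (s - 1) + ?c y * 0\<^sub>m 1 (s - 1))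
    (1\<^sub>m (s - 1) * ?c z + ?c y * 1\<^sub>m 1) (0\<^sub>m 1 (s - 1) * 1\<^sub>m (s - 1) + 1\<^sub>m 1 * 0\<^sub>m 1 (s - 1))
    (0\<^sub>m 1 (s - 1) * ?c z + 1\<^sub>m 1 * 1\<^sub>m 1)"
    unfolding umat_def by (rule mult_four_block_mat) auto
  also have "1\<^sub>m (s - 1) * ?c z + ?c y * 1\<^sub>m 1 = ?c z + ?c y"
    by (simp add: left_mult_one_mat[of _ "s - 1" 1] right_mult_one_mat[of _ "s - 1" 1])
  also have "?c z + ?c y = ?c (y + z)"
    using assms by (intro eq_matI) auto
  finally show ?thesis unfolding umat_def by simp
qed

lemma umat_0 [simp]: "0 < s \<Longrightarrow> umat s (0\<^sub>v (s - 1)) = 1\<^sub>m s"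
  by (rule eq_matI) (auto simp: umat_index carrier_matD[OF umat_carrier])

lemma det_umat: "0 < s \<Longrightarrow> det (umat s y) = 1"
  unfolding umat_def by (subst det_four_block_mat_lower_left_zero[of _ "s - 1" _ 1]) auto

lemma umat_GL [simp]: "0 < s \<Longrightarrow> umat s y \<in> GL s"
  by (simp add: GL_iff_det det_umat)

text \<open>\<open>GL (s - 1)\<close> normalises U_s and acts on it as on column vectors; dually, it
  moves the characters c by the transpose.\<close>

lemma emb_umat_commute:
  assumes "0 < s" "y \<in> carrier_vec (s - 1)" "g \<in> carrier_mat (s - 1) (s - 1)"
  shows "emb s (s - 1) g * umat s y = umat s (g *\<^sub>v y) * emb s (s - 1) g"
proof -
  have s1: "s - (s - 1) = 1" using assms by simp
  let ?c = "\<lambda>y. mat (s - 1) 1 (\<lambda>(i, _). y $ i)"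
  have "emb s (s - 1) g * umat s y = four_block_mat (g * 1\<^sub>m (s - 1) + 0\<^sub>m (s - 1) 1 * 0\<^sub>m 1 (s - 1))
    (g * ?c y + 0\<^sub>m (s - 1) 1 * 1\<^sub>m 1) (0\<^sub>m 1 (s - 1) * 1\<^sub>m (s - 1) + 1\<^sub>m 1 * 0\<^sub>m 1 (s - 1))
    (0\<^sub>m 1 (s - 1) * ?c y + 1\<^sub>m 1 * 1\<^sub>m 1)"
    unfolding umat_def emb_def s1 by (rule mult_four_block_mat) (use assms in auto)
  also have "\<dots> = four_block_mat g (g * ?c y) (0\<^sub>m 1 (s - 1)) (1\<^sub>m 1)"
    using assms by simp
  also have "g * ?c y = ?c (g *\<^sub>v y)"
    using assms by (intro eq_matI) (auto simp: scalar_prod_def)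
  finally have 1: "emb s (s - 1) g * umat s y = four_block_mat g (?c (g *\<^sub>v y)) (0\<^sub>m 1 (s - 1)) (1\<^sub>m 1)" .
  have "umat s (g *\<^sub>v y) * emb s (s - 1) g = four_block_mat (1\<^sub>m (s - 1) * g + ?c (g *\<^sub>v y) * 0\<^sub>m 1 (s - 1))
    (1\<^sub>m (s - 1) * 0\<^sub>m (s - 1) 1 + ?c (g *\<^sub>v y) * 1\<^sub>m 1) (0\<^sub>m 1 (s - 1) * g + 1\<^sub>m 1 * 0\<^sub>m 1 (s - 1))
    (0\<^sub>m 1 (s - 1) * 0\<^sub>m (s - 1) 1 + 1\<^sub>m 1 * 1\<^sub>m 1)"
    unfolding umat_def emb_def s1 by (rule mult_four_block_mat) (use assms in auto)
  also have "?c (g *\<^sub>v y) * 1\<^sub>m 1 = ?c (g *\<^sub>v y)" by (rule right_mult_one_mat[of _ "s - 1"]) simp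
  finally show ?thesis using 1 assms by simp
qed

lemma Umir_eq_range_umat:
  assumes "0 < s"
  shows "Umir s = umat s ` carrier_vec (s - 1)"
proof (intro subset_antisym subsetI)
  fix A :: "'a mat" assume A: "A \<in> Umir s"
  hence Ac: "A \<in> carrier_mat s s" by (simp add: Umir_def)
  have "A = umat s (vec (s - 1) (\<lambda>i. A $$ (i, s - 1)))"
    using A assms by (intro eq_matI) (auto simp: Umir_def umat_index carrier_matD[OF umat_carrier])
  thus "A \<in> umat s ` carrier_vec (s - 1)" by (rule image_eqI) simp
next
  fix A :: "'a mat" assume "A \<in> umat s ` carrier_vec (s - 1)"
  thus "A \<in> Umir s" using assms by (auto simp: Umir_def umat_index)
qed

lemma scalar_prod_lastv: "y \<in> carrier_vec d \<Longrightarrow> 0 < d \<Longrightarrow> lastv d \<bullet> y = y $ (d - 1)"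
  unfolding lastv_def by simp

lemma psiN_umat:
  assumes "0 < s" "y \<in> carrier_vec (s - 1)"
  shows "psiN chr s (umat s y) = chr (lastv (s - 1) \<bullet> y)"
proof (cases "s = 1")
  case True
  thus ?thesis using assms unfolding psiN_def by (simp add: scalar_prod_def)
next
  case False
  have "(\<Sum>i<s - 1. umat s y $$ (i, i + 1)) = (\<Sum>i<s - 1. if i = s - 2 then y $ i else 0)"
    using False assms by (intro sum.cong) (auto simp: umat_index)
  also have "\<dots> = y $ (s - 2)" using False assms by simp
  finally show ?thesis using False assms unfolding psiN_def by (simp add: scalar_prod_lastv numeral_2_eq_2)
qed

text \<open>Consequently the stabiliser of psi among the characters of U_(d+1) consists of the
  matrices with last row \<open>lastv d\<close>, the mirabolic subgroup of
  \<open>GL d\<close>.\<close>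

lemma transpose_mult_lastv:
  assumes "g \<in> carrier_mat d d"
  shows "transpose_mat g *\<^sub>v lastv d = row g (d - 1)"
  using assms by (cases "d = 0") (auto intro!: eq_vecI simp: lastv_def)

text \<open>The factorisation of the mirabolic P_j as U_j times G_(j-1). Inductions on the matrix
  size peel off one U_j at a time with it.\<close>

lemma last_row_decomp:
  assumes "g \<in> carrier_mat j j" "0 < j" "row g (j - 1) = lastv j"
  shows "g = umat j (vec (j - 1) (\<lambda>i. g $$ (i, j - 1))) * emb j (j - 1) (mat (j - 1) (j - 1) (\<lambda>x. g $$ x))"
    (is "g = umat j ?y * emb j _ ?g")
proof -
  have s1: "j - (j - 1) = 1" using assms by simp
  let ?c = "mat (j - 1) 1 (\<lambda>(i, _). ?y $ i)"
  have "umat j ?y * emb j (j - 1) ?g = four_block_mat (1\<^sub>m (j - 1) * ?g + ?c * 0\<^sub>m 1 (j - 1))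
    (1\<^sub>m (j - 1) * 0\<^sub>m (j - 1) 1 + ?c * 1\<^sub>m 1) (0\<^sub>m 1 (j - 1) * ?g + 1\<^sub>m 1 * 0\<^sub>m 1 (j - 1))
    (0\<^sub>m 1 (j - 1) * 0\<^sub>m (j - 1) 1 + 1\<^sub>m 1 * 1\<^sub>m 1)"
    unfolding umat_def emb_def s1 by (rule mult_four_block_mat) auto
  also have "?c * 1\<^sub>m 1 = ?c" by (rule right_mult_one_mat[of _ "j - 1"]) simp
  finally have eq: "umat j ?y * emb j (j - 1) ?g = four_block_mat ?g ?c (0\<^sub>m 1 (j - 1)) (1\<^sub>m 1)"
    by simp
  have last: "g $$ (j - 1, k) = (if k = j - 1 then 1 else 0)" if "k < j" for k
    using arg_cong[OF assms(3), of "\<lambda>v. v $ k"] assms(1,2) that by (simp add: lastv_def)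
  have idx: "i = j - 1" if "i < j" "\<not> i < j - 1" for i using that by simp
  show ?thesis
    unfolding eq
  proof (rule eq_matI)
    fix i k assume "i < dim_row (four_block_mat ?g ?c (0\<^sub>m 1 (j - 1)) (1\<^sub>m 1))"
      "k < dim_col (four_block_mat ?g ?c (0\<^sub>m 1 (j - 1)) (1\<^sub>m 1))"
    hence "i < j" "k < j" using assms(2) by auto
    thus "g $$ (i, k) = four_block_mat ?g ?c (0\<^sub>m 1 (j - 1)) (1\<^sub>m 1) $$ (i, k)"
      using last[of k] idx[of i] idx[of k] by (cases "i < j - 1"; cases "k < j - 1") auto
  qed (use assms in auto)
qed

text \<open>Read through the transpose action, this is transitivity of \<open>GL d\<close> on the
  nontrivial characters of U_(d+1). If c_i is nonzero, c is completed by the standard basis vectors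
  other than the i-th.\<close>

lemma exists_GL_last_row:
  fixes c :: "'k::field vec"
  assumes c: "c \<in> carrier_vec d" "c \<noteq> 0\<^sub>v d"
  obtains g where "g \<in> GL d" "row g (d - 1) = c"
proof -
  obtain i where i: "i < d" "c $ i \<noteq> 0" using c by (auto simp: vec_eq_iff)
  define g :: "'k mat" where
    "g = mat_of_rows d (map (\<lambda>r. if r = d - 1 then c else if r = i then unit_vec d (d - 1) else unit_vec d r) [0..<d])"
  have gc: "g \<in> carrier_mat d d" unfolding g_def by auto
  have row: "row g r = (if r = d - 1 then c else if r = i then unit_vec d (d - 1) else unit_vec d r)" if "r < d" for r
    unfolding g_def using that c by (subst mat_of_rows_row) auto
  \<comment> \<open>The rows above the last force every coordinate of a kernel vector except the
    i-th to vanish; the last row c then handles the i-th, since c_i is nonzero.\<close>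
  have "v = 0\<^sub>v d" if v: "v \<in> carrier_vec d" "g *\<^sub>v v = 0\<^sub>v d" for v
  proof -
    have r: "row g r \<bullet> v = 0" if "r < d" for r
      using arg_cong[OF v(2), of "\<lambda>v. v $ r"] that gc by simp
    have off: "v $ r = 0" if "r < d" "r \<noteq> i" for r
    proof (cases "r = d - 1")
      case True
      thus ?thesis using r[of i] row[of i] v i that by (auto split: if_splits)
    next
      case False
      thus ?thesis using r[of r] row[of r] v that by auto
    qed
    have "0 = row g (d - 1) \<bullet> v" using r[of "d - 1"] i by simp
    also have "\<dots> = (\<Sum>k\<in>{0..<d}. c $ k * v $ k)" using row[of "d - 1"] i v by (simp add: scalar_prod_def)
    also have "\<dots> = (\<Sum>k\<in>{0..<d}. if k = i then c $ i * v $ i else 0)"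
      using off by (intro sum.cong) auto
    also have "\<dots> = c $ i * v $ i" using i by simp
    finally have "v $ i = 0" using i by simp
    hence "v $ r = 0" if "r < d" for r using off that by (cases "r = i") auto
    thus ?thesis using v(1) by (intro eq_vecI) auto
  qed
  hence "det g \<noteq> 0" using det_0_iff_vec_prod_zero_field[OF gc] by blast
  thus thesis using that gc row[of "d - 1"] i by (auto simp: GL_iff_det)
qed

lemma row_emb_last:
  assumes "j \<le> d" "g \<in> carrier_mat j j" "j = d \<longrightarrow> row g (d - 1) = lastv d"
  shows "row (emb d j g) (d - 1) = lastv d"
proof (cases "j = d")
  case True
  thus ?thesis using assms by simp
next
  case False
  hence d: "j < d" using assms by simp
  show ?thesis
    using d assms carrier_matD[OF emb_carrier[of j d g]]
    by (intro eq_vecI) (auto simp: lastv_def emb_index)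
qed

lemma row_umat_last: "0 < s \<Longrightarrow> row (umat s y) (s - 1) = lastv s"
  by (intro eq_vecI) (auto simp: lastv_def umat_index carrier_matD[OF umat_carrier])

section \<open>The unitriangular group and its subgroup \<open>Uhn\<close>\<close>

lemma Nuni_iff:
  "u \<in> Nuni m \<longleftrightarrow> u \<in> carrier_mat m m \<and> (\<forall>i<m. \<forall>j<i. u $$ (i, j) = 0) \<and> (\<forall>i<m. u $$ (i, i) = 1)"
  unfolding Nuni_def by (auto intro: less_trans)

lemma Nuni_one [simp]: "1\<^sub>m m \<in> Nuni m"
  by (auto simp: Nuni_def)

lemma Nuni_carrier: "u \<in> Nuni m \<Longrightarrow> u \<in> carrier_mat m m"
  by (simp add: Nuni_def)

lemma Nuni_mult:
  assumes u: "u \<in> Nuni m" and v: "v \<in> Nuni m"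
  shows "u * v \<in> Nuni m"
proof -
  have c: "u \<in> carrier_mat m m" "v \<in> carrier_mat m m" using assms by (auto simp: Nuni_carrier)
  have idx: "(u * v) $$ (i, j) = (\<Sum>k\<in>{0..<m}. u $$ (i, k) * v $$ (k, j))" if "i < m" "j < m" for i j
    using that c by (simp add: scalar_prod_def)
  have low: "(u * v) $$ (i, j) = 0" if "j < i" "i < m" for i j
    unfolding idx[OF that(2) less_trans[OF that]]
  proof (rule sum.neutral, intro ballI)
    fix k assume "k \<in> {0..<m}"
    thus "u $$ (i, k) * v $$ (k, j) = 0"
      using u v that by (cases "k < i") (auto simp: Nuni_def)
  qed
  have diag: "(u * v) $$ (i, i) = 1" if "i < m" for i
  proof -
    have "(u * v) $$ (i, i) = (\<Sum>k\<in>{0..<m}. if k = i then 1 else 0)"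
      unfolding idx[OF that that]
    proof (rule sum.cong[OF refl])
      fix k assume "k \<in> {0..<m}"
      thus "u $$ (i, k) * v $$ (k, i) = (if k = i then 1 else 0)"
        using u v that by (cases k i rule: linorder_cases) (auto simp: Nuni_def)
    qed
    thus ?thesis using that by simp
  qed
  show ?thesis unfolding Nuni_def using c low diag by auto
qed

lemma Nuni_last_row:
  assumes "u \<in> Nuni j" "0 < j"
  shows "row u (j - 1) = lastv j"
  using assms by (intro eq_vecI) (auto simp: Nuni_def lastv_def)

lemma Nuni_GL: "u \<in> Nuni m \<Longrightarrow> u \<in> GL m"
proof -
  assume u: "u \<in> Nuni m"
  hence "upper_triangular u" "u \<in> carrier_mat m m" by (auto simp: Nuni_def upper_triangular_def)
  hence "det u = prod_list (diag_mat u)" by (rule det_upper_triangular)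
  moreover have "diag_mat u = replicate m 1"
    using u by (intro nth_equalityI) (auto simp: diag_mat_def Nuni_def)
  ultimately show ?thesis using u by (auto simp: GL_iff_det Nuni_carrier)
qed

text \<open>Inverses come from finiteness: right multiplication by \<open>v\<close> is an injective self-map of the finite
  set \<open>Nuni m\<close>.\<close>
lemma Nuni_coset:
  fixes v :: "'k::{field,finite} mat"
  assumes v: "v \<in> Nuni m"
  shows "{u * v | u. u \<in> Nuni m} = Nuni m"
proof -
  have fin: "finite (Nuni m :: 'k mat set)"
    by (rule finite_subset[OF _ finite_carrier_mat[of m m]]) (auto simp: Nuni_carrier)
  obtain w where w: "w \<in> GL m" "v * w = 1\<^sub>m m" using GL_inverse[OF Nuni_GL[OF v]] by metis
  have inj: "inj_on (\<lambda>u. u * v) (Nuni m)"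
  proof (rule inj_onI)
    fix a b assume ab: "a \<in> Nuni m" "b \<in> Nuni m" "a * v = b * v"
    have "a * v * w = b * v * w" using ab by simp
    moreover have "a * v * w = a" "b * v * w = b"
      using ab(1,2) v w
      by (simp_all add: assoc_mult_mat[of _ m m _ m _ m] Nuni_carrier GL_carrier right_mult_one_mat[of _ m m])
    ultimately show "a = b" by simp
  qed
  have "(\<lambda>u. u * v) ` Nuni m = Nuni m"
    using v by (intro endo_inj_surj[OF fin _ inj]) (auto intro: Nuni_mult)
  thus ?thesis by (auto simp: image_def)
qed

lemma Nuni_upper_left:
  "u \<in> Nuni j \<Longrightarrow> mat (j - 1) (j - 1) (\<lambda>x. u $$ x) \<in> Nuni (j - 1)"
  by (simp add: Nuni_iff)

lemma emb_Nuni: "m \<le> n \<Longrightarrow> u \<in> Nuni m \<Longrightarrow> emb n m u \<in> Nuni n"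
  by (auto simp: Nuni_def emb_index)

lemma Nuni_emb_umat:
  assumes "g \<in> Nuni (j - 1)" "0 < j"
  shows "umat j y * emb j (j - 1) g \<in> Nuni j"
  by (rule Nuni_mult[OF _ emb_Nuni]) (use assms in \<open>auto simp: Nuni_def umat_index\<close>)

lemma psiN_emb:
  assumes "m \<le> n" "u \<in> carrier_mat m m"
  shows "psiN chr n (emb n m u) = psiN chr m u"
proof -
  have "(\<Sum>i<n - 1. emb n m u $$ (i, i + 1)) = (\<Sum>i<n - 1. if i < m - 1 then u $$ (i, i + 1) else 0)"
    using assms by (intro sum.cong) (auto simp: emb_index)
  also have "\<dots> = (\<Sum>i<m - 1. u $$ (i, i + 1))"
    using assms by (intro sum.mono_neutral_cong_right) auto
  finally show ?thesis by (simp add: psiN_def)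
qed

lemma Uhn_Nuni: "u \<in> Uhn n m \<Longrightarrow> u \<in> Nuni n"
proof -
  assume "u \<in> Uhn n m"
  hence c: "u \<in> carrier_mat n n" and
    u: "\<And>i j. i < n \<Longrightarrow> j < n \<Longrightarrow> j \<le> m \<or> m < i \<and> j \<le> i \<Longrightarrow> u $$ (i, j) = (if i = j then 1 else 0)"
    by (auto simp: Uhn_def)
  have "u $$ (i, j) = 0" if "i < n" "j < i" for i j using u[of i j] that by simp linarith
  moreover have "u $$ (i, i) = 1" if "i < n" for i using u[of i i] that by simp linarith
  ultimately show ?thesis using c by (simp add: Nuni_iff)
qed

lemma Uhn_one [simp]: "1\<^sub>m n \<in> Uhn n m"
  by (auto simp: Uhn_def)

lemma psiN_one: "psiN chr n (1\<^sub>m n) = chr 0"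
  unfolding psiN_def by (intro arg_cong[of _ _ chr] sum.neutral) auto

text \<open>The free entries of U_s lie in column s - 1, while columns 0 to m in \<open>Uhn\<close>
  are those of the identity; hence the bound m + 2 on s.\<close>

lemma emb_umat_Uhn:
  assumes "m + 2 \<le> s" "s \<le> n"
  shows "emb n s (umat s y) \<in> Uhn n m"
  using assms umat_carrier[of s y] by (auto simp: Uhn_def emb_index umat_index)

text \<open>Conjugation by g replaces the upper right block Z by g Z. Column m of u is a column of
  the identity, so the first column of Z is zero and stays zero; hence the superdiagonal, and with
  it psi, does not change.\<close>

lemma Uhn_conjugate:
  assumes g: "g \<in> carrier_mat m m" and u: "u \<in> Uhn n m" and mn: "m < n"
  obtains u' where "u' \<in> Uhn n m" "emb n m g * u = u' * emb n m g" "psiN chr n u' = psiN chr n u"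
proof -
  let ?k = "n - m"
  have uc: "u \<in> carrier_mat n n" and
    ui: "\<And>i j. i < n \<Longrightarrow> j < n \<Longrightarrow> j \<le> m \<Longrightarrow> u $$ (i, j) = (if i = j then 1 else 0)"
    "\<And>i j. i < n \<Longrightarrow> j < n \<Longrightarrow> m < i \<Longrightarrow> j \<le> i \<Longrightarrow> u $$ (i, j) = (if i = j then 1 else 0)"
    using u by (auto simp: Uhn_def)
  define Z where "Z = mat m ?k (\<lambda>(i, j). u $$ (i, j + m))"
  define Y where "Y = mat ?k ?k (\<lambda>(i, j). u $$ (i + m, j + m))"
  have ZY: "Z \<in> carrier_mat m ?k" "Y \<in> carrier_mat ?k ?k" by (auto simp: Z_def Y_def)
  have ueq: "u = four_block_mat (1\<^sub>m m) Z (0\<^sub>m ?k m) Y"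
    using uc mn ui(1) by (intro eq_matI) (auto simp: Z_def Y_def)
  define u' where "u' = four_block_mat (1\<^sub>m m) (g * Z) (0\<^sub>m ?k m) Y"
  have u'c: "u' \<in> carrier_mat n n"
    unfolding u'_def using four_block_carrier_mat[of "1\<^sub>m m" m m Y ?k ?k] ZY mn by simp
  have gZ: "(g * Z) $$ (i, 0) = 0" if "i < m" for i
  proof -
    have "(g * Z) $$ (i, 0) = (\<Sum>k\<in>{0..<m}. g $$ (i, k) * Z $$ (k, 0))"
      using that g ZY mn by (simp add: scalar_prod_def)
    also have "\<dots> = 0"
      using ui(1) mn by (intro sum.neutral) (auto simp: Z_def)
    finally show ?thesis .
  qed
  have low: "u' $$ (i, j) = u $$ (i, j)" if "i < n" "j < n" "m \<le> i \<or> j \<le> m" for i j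
  proof (cases "i < m")
    case True
    hence "j \<le> m" using that by simp
    thus ?thesis using that True ui(1)[of i j] g ZY mn gZ[of i]
      by (cases "j = m") (auto simp: u'_def)
  next
    case False
    thus ?thesis using that ui(1)[of i j] g ZY mn
      by (cases "j < m") (auto simp: u'_def Y_def)
  qed
  have "u' \<in> Uhn n m"
    unfolding Uhn_def using u'c low ui by auto
  moreover have "emb n m g * u = u' * emb n m g"
  proof -
    have "emb n m g * u = four_block_mat (g * 1\<^sub>m m + 0\<^sub>m m ?k * 0\<^sub>m ?k m) (g * Z + 0\<^sub>m m ?k * Y)
      (0\<^sub>m ?k m * 1\<^sub>m m + 1\<^sub>m ?k * 0\<^sub>m ?k m) (0\<^sub>m ?k m * Z + 1\<^sub>m ?k * Y)"
      unfolding emb_def ueq by (rule mult_four_block_mat) (use g ZY in auto)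
    also have "\<dots> = four_block_mat g (g * Z) (0\<^sub>m ?k m) Y"
      using g ZY by simp
    finally have 1: "emb n m g * u = four_block_mat g (g * Z) (0\<^sub>m ?k m) Y" .
    have "u' * emb n m g = four_block_mat (1\<^sub>m m * g + g * Z * 0\<^sub>m ?k m) (1\<^sub>m m * 0\<^sub>m m ?k + g * Z * 1\<^sub>m ?k)
      (0\<^sub>m ?k m * g + Y * 0\<^sub>m ?k m) (0\<^sub>m ?k m * 0\<^sub>m m ?k + Y * 1\<^sub>m ?k)"
      unfolding emb_def u'_def by (rule mult_four_block_mat) (use g ZY in auto)
    also have "\<dots> = four_block_mat g (g * Z) (0\<^sub>m ?k m) Y"
      using g ZY by simp
    finally show ?thesis using 1 by simp
  qed
  moreover have "psiN chr n u' = psiN chr n u"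
    unfolding psiN_def by (intro arg_cong[of _ _ chr] sum.cong refl low) auto
  ultimately show thesis using that by blast
qed

declare GL_carrier [simp]

text \<open>The dimension \<open>s - 1\<close> is pervasive and must not be rewritten to \<open>s - Suc 0\<close>.\<close>
declare One_nat_def [simp del]

section \<open>Function spaces under right translation\<close>

lemma sum_fun_apply: "(\<Sum>i\<in>A. f i) x = (\<Sum>i\<in>A. f i x)"
  for f :: "'i \<Rightarrow> 'a \<Rightarrow> 'b::comm_monoid_add"
  by (induction A rule: infinite_finite_induct) auto

lemma fscale_apply [simp]: "fscale r f x = r * f x"
  by (simp add: fscale_def)

interpretation fs: Modules.module fscale
  by unfold_locales (auto simp: fun_eq_iff algebra_simps)

lemma rt_rt:
  assumes "g \<in> GL N" "h \<in> GL N"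
  shows "rt N g (rt N h x) = rt N (g * h) x"
  using assms by (auto simp: rt_def fun_eq_iff assoc_mult_mat[of _ N N _ N _ N])

lemma rt_one: "(\<And>g. g \<notin> GL N \<Longrightarrow> x g = 0) \<Longrightarrow> rt N (1\<^sub>m N) x = x"
  by (auto simp: rt_def fun_eq_iff right_mult_one_mat[of _ N N])

lemma rt_fscale: "rt N g (fscale r x) = fscale r (rt N g x)"
  by (auto simp: rt_def fun_eq_iff)

lemma rt_sum: "rt N g (\<Sum>i\<in>A. f i) = (\<Sum>i\<in>A. rt N g (f i))"
  by (auto simp: rt_def fun_eq_iff sum_fun_apply)

text \<open>The common shape of \<open>W\<close> and \<open>W'\<close>. The functions vanish off
  \<open>GL N\<close> because \<open>rt\<close> cuts them off there; this makes the identity matrix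
  act as the identity.\<close>

definition invariant_space :: "nat \<Rightarrow> ('k::field mat \<Rightarrow> 'r::comm_ring_1) set \<Rightarrow> bool" where
  "invariant_space N W \<longleftrightarrow> fs.subspace W \<and> (\<forall>g\<in>GL N. \<forall>x\<in>W. rt N g x \<in> W)
     \<and> (\<forall>x\<in>W. \<forall>g. g \<notin> GL N \<longrightarrow> x g = 0)"

lemma invariant_spaceD:
  assumes "invariant_space N W"
  shows "fs.subspace W" "g \<in> GL N \<Longrightarrow> x \<in> W \<Longrightarrow> rt N g x \<in> W" "x \<in> W \<Longrightarrow> g \<notin> GL N \<Longrightarrow> x g = 0"
  using assms by (auto simp: invariant_space_def)

abbreviation uelt :: "nat \<Rightarrow> nat \<Rightarrow> 'k::field vec \<Rightarrow> 'k mat" where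
  "uelt N s y \<equiv> emb N s (umat s y)"

lemma mult_inverse_mat_vec:
  fixes g :: "'k::field mat"
  assumes "g \<in> carrier_mat d d" "h \<in> carrier_mat d d" "g * h = 1\<^sub>m d" "y \<in> carrier_vec d"
  shows "g *\<^sub>v (h *\<^sub>v y) = y"
  using assms assoc_mult_mat_vec[OF assms(1,2,4)] one_mult_mat_vec[OF assms(4)] by simp

lemma uelt_mult:
  assumes "0 < s" "s \<le> N" "y \<in> carrier_vec (s - 1)" "z \<in> carrier_vec (s - 1)"
  shows "uelt N s y * uelt N s z = uelt N s (y + z)"
  using assms by (simp add: umat_mult flip: emb_mult)

lemma emb_uelt_commute:
  assumes "0 < s" "s \<le> N" "y \<in> carrier_vec (s - 1)" "g \<in> carrier_mat (s - 1) (s - 1)"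
  shows "emb N (s - 1) g * uelt N s y = uelt N s (g *\<^sub>v y) * emb N (s - 1) g"
proof -
  have e: "emb N (s - 1) g = emb N s (emb s (s - 1) g)" using assms by (simp add: emb_emb)
  show ?thesis unfolding e using assms by (simp add: emb_umat_commute flip: emb_mult)
qed

section \<open>Projectors for the characters of U_s\<close>

context additive_character
begin

text \<open>The projector onto the part on which \<open>U_s\<close> acts through the character \<open>psi (c \<bullet> y)\<close>.\<close>
definition pr :: "nat \<Rightarrow> nat \<Rightarrow> 'k vec \<Rightarrow> ('k mat \<Rightarrow> 'r) \<Rightarrow> 'k mat \<Rightarrow> 'r" where
  "pr N s c x = fscale (card_inv (s - 1))
     (\<Sum>y\<in>carrier_vec (s - 1). fscale (psi (- (c \<bullet> y))) (rt N (uelt N s y) x))"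

lemma pr_apply:
  "pr N s c x g = (if g \<in> GL N then card_inv (s - 1) *
     (\<Sum>y\<in>carrier_vec (s - 1). psi (- (c \<bullet> y)) * x (g * uelt N s y)) else 0)"
  by (simp add: pr_def sum_fun_apply rt_def)

lemma pr_add: "pr N s c (x + y) = pr N s c x + pr N s c y"
  by (auto simp: pr_apply fun_eq_iff sum.distrib algebra_simps)

lemma pr_fscale: "pr N s c (fscale r x) = fscale r (pr N s c x)"
  by (auto simp: pr_apply fun_eq_iff sum_distrib_left mult_ac)

lemma pr_diff: "pr N s c (x - y) = pr N s c x - pr N s c y"
  by (auto simp: pr_apply fun_eq_iff sum_subtractf algebra_simps)

lemma pr_zero [simp]: "pr N s c 0 = 0"
  using pr_diff[of N s c 0 0] by simp

lemma pr_in: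
  assumes "invariant_space N W" "x \<in> W" "0 < s" "s \<le> N"
  shows "pr N s c x \<in> W"
  unfolding pr_def
  by (intro fs.subspace_scale fs.subspace_sum invariant_spaceD[OF assms(1)] emb_GL umat_GL assms)

lemma pr_rt_uelt:
  assumes s: "0 < s" "s \<le> N" and c: "c \<in> carrier_vec (s - 1)" and z: "z \<in> carrier_vec (s - 1)"
  shows "pr N s c (rt N (uelt N s z) x) = fscale (psi (c \<bullet> z)) (pr N s c x)"
proof
  fix g
  show "pr N s c (rt N (uelt N s z) x) g = fscale (psi (c \<bullet> z)) (pr N s c x) g"
  proof (cases "g \<in> GL N")
    case g: True
    have "(\<Sum>y\<in>carrier_vec (s - 1). psi (- (c \<bullet> y)) * rt N (uelt N s z) x (g * uelt N s y))
      = (\<Sum>y\<in>carrier_vec (s - 1). psi (c \<bullet> z) * (psi (- (c \<bullet> y)) * x (g * uelt N s y)))"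
    proof (rule sum.reindex_bij_witness[of _ "\<lambda>y. y - z" "\<lambda>y. y + z"])
      fix y :: "'k vec" assume y: "y \<in> carrier_vec (s - 1)"
      have "rt N (uelt N s z) x (g * uelt N s y) = x (g * (uelt N s y * uelt N s z))"
        using g s by (simp add: rt_def assoc_mult_mat[of _ N N _ N _ N])
      also have "\<dots> = x (g * uelt N s (y + z))" using uelt_mult s y z by metis
      finally have 1: "rt N (uelt N s z) x (g * uelt N s y) = x (g * uelt N s (y + z))" .
      have "psi (c \<bullet> z) * psi (- (c \<bullet> (y + z))) = psi (- (c \<bullet> y))"
        using c y z by (simp add: scalar_prod_add_distrib[of _ "s - 1"] flip: psi_add)
      thus "psi (c \<bullet> z) * (psi (- (c \<bullet> (y + z))) * x (g * uelt N s (y + z)))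
        = psi (- (c \<bullet> y)) * rt N (uelt N s z) x (g * uelt N s y)"
        unfolding 1 by (simp flip: mult.assoc)
    qed (use z in \<open>auto simp: vec_eq_iff\<close>)
    thus ?thesis using g by (simp add: pr_apply sum_distrib_left mult_ac)
  qed (simp add: pr_apply)
qed

lemma rt_uelt_pr:
  assumes s: "0 < s" "s \<le> N" and c: "c \<in> carrier_vec (s - 1)" and z: "z \<in> carrier_vec (s - 1)"
  shows "rt N (uelt N s z) (pr N s c x) = fscale (psi (c \<bullet> z)) (pr N s c x)"
proof -
  have "rt N (uelt N s z) (pr N s c x) = pr N s c (rt N (uelt N s z) x)"
  proof -
    have "uelt N s z * uelt N s y = uelt N s y * uelt N s z" if "y \<in> carrier_vec (s - 1)" for y
      using uelt_mult[OF s z that] uelt_mult[OF s that z] comm_add_vec[OF z that] by simp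
    thus ?thesis using s unfolding pr_def
      by (simp add: rt_fscale rt_sum rt_rt cong: sum.cong)
  qed
  thus ?thesis using pr_rt_uelt[OF assms] by simp
qed

text \<open>Fourier inversion on U_s: after exchanging the sums, orthogonality in c leaves only the
  term y = 0.\<close>

lemma sum_pr:
  assumes s: "0 < s" "s \<le> N" and x: "\<And>g. g \<notin> GL N \<Longrightarrow> x g = 0"
  shows "(\<Sum>c\<in>carrier_vec (s - 1). pr N s c x) = x"
proof
  fix g
  let ?V = "carrier_vec (s - 1) :: 'k vec set"
  show "(\<Sum>c\<in>?V. pr N s c x) g = x g"
  proof (cases "g \<in> GL N")
    case g: True
    have "(\<Sum>c\<in>?V. pr N s c x) g =
      card_inv (s - 1) * (\<Sum>c\<in>?V. \<Sum>y\<in>?V. psi (- (c \<bullet> y)) * x (g * uelt N s y))"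
      using g by (simp add: sum_fun_apply pr_apply sum_distrib_left)
    also have "(\<Sum>c\<in>?V. \<Sum>y\<in>?V. psi (- (c \<bullet> y)) * x (g * uelt N s y))
      = (\<Sum>y\<in>?V. (\<Sum>c\<in>?V. psi (- (c \<bullet> y))) * x (g * uelt N s y))"
      by (subst sum.swap) (simp add: sum_distrib_right)
    also have "\<dots> = (\<Sum>y\<in>?V. if y = 0\<^sub>v (s - 1) then of_nat (CARD('k) ^ (s - 1)) * x g else 0)"
    proof (rule sum.cong[OF refl])
      fix y assume y: "y \<in> ?V"
      have "(\<Sum>c\<in>?V. psi (- (c \<bullet> y))) = (\<Sum>c\<in>?V. psi ((- y) \<bullet> c))"
      proof (rule sum.cong[OF refl])
        fix c assume "c \<in> ?V"
        thus "psi (- (c \<bullet> y)) = psi ((- y) \<bullet> c)"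
          using y by (simp add: comm_scalar_prod[of c "s - 1"])
      qed
      also have "\<dots> = (if - y = 0\<^sub>v (s - 1) then of_nat (CARD('k) ^ (s - 1)) else 0)"
        by (rule psi_sum_scalar_prod) (use y in simp)
      also have "- y = 0\<^sub>v (s - 1) \<longleftrightarrow> y = 0\<^sub>v (s - 1)" using y by (auto simp: vec_eq_iff)
      finally show "(\<Sum>c\<in>?V. psi (- (c \<bullet> y))) * x (g * uelt N s y)
        = (if y = 0\<^sub>v (s - 1) then of_nat (CARD('k) ^ (s - 1)) * x g else 0)"
        using s g by (simp add: right_mult_one_mat[of _ N N])
    qed
    also have "\<dots> = of_nat (CARD('k) ^ (s - 1)) * x g" by simp
    finally show ?thesis using card_inv(2)[of "s - 1"] by (simp flip: mult.assoc)
  qed (simp add: sum_fun_apply pr_apply x)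
qed

text \<open>Substitute g y for y in the average and move g across the pairing to c.\<close>

lemma pr_rt_emb:
  assumes s: "0 < s" "s \<le> N" and c: "c \<in> carrier_vec (s - 1)" and g: "g \<in> GL (s - 1)"
  shows "pr N s c (rt N (emb N (s - 1) g) x) = rt N (emb N (s - 1) g) (pr N s (transpose_mat g *\<^sub>v c) x)"
proof -
  let ?V = "carrier_vec (s - 1) :: 'k vec set"
  obtain h where h: "h \<in> GL (s - 1)" "g * h = 1\<^sub>m (s - 1)" "h * g = 1\<^sub>m (s - 1)" using GL_inverse[OF g] by metis
  have gc: "g \<in> carrier_mat (s - 1) (s - 1)" "h \<in> carrier_mat (s - 1) (s - 1)" using g h by auto
  let ?G = "emb N (s - 1) g"
  have G: "?G \<in> GL N" using g s by simp
  have "(\<Sum>y\<in>?V. fscale (psi (- (c \<bullet> y))) (rt N (uelt N s y) (rt N ?G x)))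
    = (\<Sum>y\<in>?V. fscale (psi (- ((transpose_mat g *\<^sub>v c) \<bullet> y))) (rt N ?G (rt N (uelt N s y) x)))"
  proof (rule sum.reindex_bij_witness[of _ "\<lambda>y. g *\<^sub>v y" "\<lambda>y. h *\<^sub>v y"])
    fix y assume y: "y \<in> ?V"
    show "h *\<^sub>v y \<in> ?V" "g *\<^sub>v y \<in> ?V" using gc y by auto
    show ghy: "g *\<^sub>v (h *\<^sub>v y) = y" using gc y h by (simp add: mult_inverse_mat_vec)
    show "h *\<^sub>v (g *\<^sub>v y) = y" by (rule mult_inverse_mat_vec[OF gc(2,1) h(3) y])
    have hy: "h *\<^sub>v y \<in> ?V" using gc y by auto
    have "(transpose_mat g *\<^sub>v c) \<bullet> (h *\<^sub>v y) = c \<bullet> (g *\<^sub>v (h *\<^sub>v y))"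
      using transpose_vec_mult_scalar[OF gc(1) hy c] by simp
    moreover have "rt N ?G (rt N (uelt N s (h *\<^sub>v y)) x) = rt N (uelt N s y) (rt N ?G x)"
      using emb_uelt_commute[OF s hy gc(1)] G s by (simp add: rt_rt ghy)
    ultimately show "fscale (psi (- ((transpose_mat g *\<^sub>v c) \<bullet> (h *\<^sub>v y)))) (rt N ?G (rt N (uelt N s (h *\<^sub>v y)) x))
      = fscale (psi (- (c \<bullet> y))) (rt N (uelt N s y) (rt N ?G x))" by (simp add: ghy)
  qed
  thus ?thesis unfolding pr_def by (simp add: rt_fscale rt_sum)
qed

text \<open>The product of the \<open>psi\<close>-projectors of \<open>U_N, \<dots>, U_(N-i+1)\<close>: it realises the \<open>i\<close>-th power of
  the functor \<open>Phi^-\<close> as a direct summand.\<close>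
primrec Q :: "nat \<Rightarrow> nat \<Rightarrow> ('k mat \<Rightarrow> 'r) \<Rightarrow> 'k mat \<Rightarrow> 'r" where
  "Q N 0 x = x"
| "Q N (Suc i) x = pr N (N - i) (lastv (N - i - 1)) (Q N i x)"

lemma Q_add: "Q N i (x + y) = Q N i x + Q N i y"
  by (induction i) (simp_all only: Q.simps pr_add)

lemma Q_diff: "Q N i (x - y) = Q N i x - Q N i y"
  by (induction i) (simp_all only: Q.simps pr_diff)

lemma Q_fscale: "Q N i (fscale r x) = fscale r (Q N i x)"
  by (induction i) (simp_all only: Q.simps pr_fscale)

lemma Q_in: "invariant_space N W \<Longrightarrow> x \<in> W \<Longrightarrow> i \<le> N \<Longrightarrow> Q N i x \<in> W"
  by (induction i) (auto intro: pr_in)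

text \<open>Each projector in \<open>Q N i\<close> belongs to some U_s with s - 1 \<ge> N - i, and a
  matrix in \<open>GL (s - 1)\<close> with last row \<open>lastv\<close> fixes its character. For j
  < s - 1 the embedded matrix has this last row automatically, so the row condition matters only at
  j = N - i.\<close>

lemma Q_rt_emb:
  assumes "i \<le> N" "j \<le> N - i" "g \<in> GL j" "j = N - i \<longrightarrow> row g (j - 1) = lastv j"
  shows "Q N i (rt N (emb N j g) x) = rt N (emb N j g) (Q N i x)"
  using assms
proof (induction i)
  case (Suc i)
  let ?d = "N - i - 1"
  have IH: "Q N i (rt N (emb N j g) x) = rt N (emb N j g) (Q N i x)"
  proof (rule Suc.IH)
    have "j < N - i" using Suc.prems by linarith
    thus "j \<le> N - i" "j = N - i \<longrightarrow> row g (j - 1) = lastv j" by auto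
  qed (use Suc.prems in auto)
  have jd: "j \<le> ?d" "?d \<le> N" using Suc.prems by auto
  let ?h = "emb ?d j g"
  have h: "?h \<in> GL ?d" using jd Suc.prems by simp
  have e: "emb N j g = emb N ?d ?h" using jd Suc.prems by (simp add: emb_emb)
  have "row ?h (?d - 1) = lastv ?d"
    using Suc.prems jd by (intro row_emb_last) (auto simp flip: Suc_eq_plus1)
  hence t: "transpose_mat ?h *\<^sub>v lastv ?d = lastv ?d"
    using h transpose_mult_lastv by (metis GL_carrier)
  have "pr N (N - i) (lastv ?d) (rt N (emb N ?d ?h) (Q N i x))
    = rt N (emb N ?d ?h) (pr N (N - i) (transpose_mat ?h *\<^sub>v lastv ?d) (Q N i x))"
    by (rule pr_rt_emb) (use h Suc.prems in auto)
  thus ?case unfolding Q.simps IH unfolding t e .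
qed simp

text \<open>The element of U_(N-i) passes through \<open>Q N i\<close> because its last row is
  \<open>lastv\<close>; the outermost projector then absorbs it.\<close>

lemma Q_Suc_rt_uelt:
  assumes "i < N" "y \<in> carrier_vec (N - i - 1)"
  shows "Q N (Suc i) (rt N (uelt N (N - i) y) x) = fscale (psi (lastv (N - i - 1) \<bullet> y)) (Q N (Suc i) x)"
proof -
  have "Q N i (rt N (uelt N (N - i) y) x) = rt N (uelt N (N - i) y) (Q N i x)"
    using assms row_umat_last[of "N - i" y] by (intro Q_rt_emb) auto
  thus ?thesis using pr_rt_uelt[of "N - i" N "lastv (N - i - 1)" y] assms by simp
qed

section \<open>Left and right equivariance, Bessel functions\<close>

definition right_equivariant :: "nat \<Rightarrow> nat \<Rightarrow> ('k mat \<Rightarrow> 'r) \<Rightarrow> bool" where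
  "right_equivariant N s x \<longleftrightarrow>
     (\<forall>z\<in>carrier_vec (s - 1). rt N (uelt N s z) x = fscale (psi (lastv (s - 1) \<bullet> z)) x)"

text \<open>For j < s the group U_j lies in the mirabolic subgroup of \<open>GL (s - 1)\<close>,
  which normalises U_s and fixes psi on it. Hence later projectors in \<open>Q\<close> keep the
  equivariance won by earlier ones.\<close>

lemma right_equivariant_rt_uelt:
  assumes x: "right_equivariant N s x" and j: "0 < j" "j < s" "s \<le> N"
  shows "right_equivariant N s (rt N (uelt N j y) x)"
  unfolding right_equivariant_def
proof
  fix z :: "'k vec" assume z: "z \<in> carrier_vec (s - 1)"
  let ?d = "s - 1"
  define g where "g = emb ?d j (umat j y)"
  have g: "g \<in> GL ?d" unfolding g_def using j by simp
  have e: "uelt N j y = emb N ?d g" unfolding g_def using j by (subst emb_emb) auto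
  have row: "row g (?d - 1) = lastv ?d" unfolding g_def
    using j row_umat_last[of j y] by (intro row_emb_last) auto
  obtain h where h: "h \<in> GL ?d" "g * h = 1\<^sub>m ?d" using GL_inverse[OF g] by metis
  have gc: "g \<in> carrier_mat ?d ?d" "h \<in> carrier_mat ?d ?d" using g h by auto
  define w where "w = h *\<^sub>v z"
  have w: "w \<in> carrier_vec ?d" unfolding w_def using gc z by auto
  have gw: "g *\<^sub>v w = z" unfolding w_def using gc z h by (simp add: mult_inverse_mat_vec)
  have "lastv ?d \<bullet> z = (transpose_mat g *\<^sub>v lastv ?d) \<bullet> w"
    using transpose_vec_mult_scalar[OF gc(1) w lastv_carrier] gw by simp
  also have "transpose_mat g *\<^sub>v lastv ?d = lastv ?d" using transpose_mult_lastv[OF gc(1)] row by simp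
  finally have l: "lastv ?d \<bullet> z = lastv ?d \<bullet> w" .
  have "rt N (uelt N s z) (rt N (emb N ?d g) x) = rt N (emb N ?d g) (rt N (uelt N s w) x)"
    using emb_uelt_commute[of s N w g] gw g gc w j by (simp add: rt_rt)
  also have "rt N (uelt N s w) x = fscale (psi (lastv ?d \<bullet> w)) x"
    using x w by (simp add: right_equivariant_def)
  finally show "rt N (uelt N s z) (rt N (uelt N j y) x) = fscale (psi (lastv ?d \<bullet> z)) (rt N (uelt N j y) x)"
    unfolding e l by (simp only: rt_fscale)
qed

lemma right_equivariant_pr:
  assumes x: "right_equivariant N s x" and j: "0 < j" "j < s" "s \<le> N"
  shows "right_equivariant N s (pr N j c x)"
proof -
  have "rt N (uelt N s z) (rt N (uelt N j y) x) = fscale (psi (lastv (s - 1) \<bullet> z)) (rt N (uelt N j y) x)"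
    if "z \<in> carrier_vec (s - 1)" for z y
    using right_equivariant_rt_uelt[OF assms] that by (simp add: right_equivariant_def)
  thus ?thesis
    unfolding right_equivariant_def pr_def
    by (simp add: rt_fscale rt_sum fs.scale_sum_right mult_ac)
qed

lemma right_equivariant_Q:
  assumes "i \<le> N" "N - i < s" "s \<le> N"
  shows "right_equivariant N s (Q N i x)"
  using assms
proof (induction i)
  case (Suc i)
  show ?case
  proof (cases "s = N - i")
    case True
    thus ?thesis using Suc.prems rt_uelt_pr[of s N "lastv (s - 1)"]
      by (auto simp: right_equivariant_def)
  next
    case False
    thus ?thesis using Suc by (auto intro!: right_equivariant_pr)
  qed
qed simp

definition left_equivariant :: "nat \<Rightarrow> ('k mat \<Rightarrow> 'r) \<Rightarrow> bool" where
  "left_equivariant N x \<longleftrightarrow> (\<forall>u\<in>Nuni N. \<forall>g\<in>GL N. x (u * g) = psiN psi N u * x g)"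

lemma left_equivariant_uelt:
  assumes "left_equivariant N x" "0 < s" "s \<le> N" "y \<in> carrier_vec (s - 1)" "g \<in> GL N"
  shows "x (uelt N s y * g) = psi (lastv (s - 1) \<bullet> y) * x g"
proof -
  have "uelt N s y \<in> Nuni N"
    using assms umat_carrier[of s y] by (intro emb_Nuni) (auto simp: Nuni_iff umat_index)
  thus ?thesis using assms by (simp add: left_equivariant_def psiN_emb psiN_umat)
qed

lemma left_equivariant_pr:
  assumes x: "left_equivariant N x" and s: "0 < s" "s \<le> N"
  shows "left_equivariant N (pr N s c x)"
  unfolding left_equivariant_def
proof (intro ballI)
  fix u g :: "'k mat" assume u: "u \<in> Nuni N" and g: "g \<in> GL N"
  have "x (u * g * uelt N s y) = psiN psi N u * x (g * uelt N s y)" for y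
    using x u g s Nuni_carrier[OF u]
    by (simp add: left_equivariant_def assoc_mult_mat[of _ N N _ N _ N])
  thus "pr N s c x (u * g) = psiN psi N u * pr N s c x g"
    using g Nuni_GL[OF u] by (simp add: pr_apply sum_distrib_left mult_ac)
qed

lemma left_equivariant_Q: "left_equivariant N x \<Longrightarrow> i \<le> N \<Longrightarrow> left_equivariant N (Q N i x)"
  by (induction i) (auto intro: left_equivariant_pr)

text \<open>At the identity, right translation by U_s is also left translation, so left equivariance
  makes all terms of the average equal.\<close>

lemma pr_lastv_one:
  assumes x: "left_equivariant N x" and s: "0 < s" "s \<le> N"
  shows "pr N s (lastv (s - 1)) x (1\<^sub>m N) = x (1\<^sub>m N)"
proof -
  have "psi (- (lastv (s - 1) \<bullet> y)) * x (1\<^sub>m N * uelt N s y) = x (1\<^sub>m N)"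
    if "y \<in> carrier_vec (s - 1)" for y :: "'k vec"
  proof -
    have "uelt N s y = uelt N s y * 1\<^sub>m N" "1\<^sub>m N * uelt N s y = uelt N s y"
      using s by (simp_all add: right_mult_one_mat[of _ N N] left_mult_one_mat[of _ N N])
    hence "x (1\<^sub>m N * uelt N s y) = psi (lastv (s - 1) \<bullet> y) * x (1\<^sub>m N)"
      using left_equivariant_uelt[OF x s that GL_one] by simp
    thus ?thesis by (simp flip: mult.assoc psi_add)
  qed
  thus ?thesis
    by (simp add: pr_apply card_carrier_vec card_inv flip: mult.assoc)
qed

lemma Q_one: "left_equivariant N x \<Longrightarrow> i \<le> N \<Longrightarrow> Q N i x (1\<^sub>m N) = x (1\<^sub>m N)"
proof (induction i)
  case (Suc i)
  thus ?case using pr_lastv_one[OF left_equivariant_Q[of N x i], of "N - i"] by simp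
qed simp

text \<open>At an embedded g in \<open>GL j\<close>, right translation by z in U_(j+1) is left
  translation by g z; comparing the two characters forces the last row of g to be
  \<open>lastv j\<close>. Then g = u h with u in U_j and h in \<open>GL (j - 1)\<close>, where u
  contributes only a value of psi, and the induction continues with h.\<close>

lemma bessel_support:
  assumes x: "left_equivariant N x" and r: "\<And>s. 0 < s \<Longrightarrow> s \<le> N \<Longrightarrow> 1 < s \<Longrightarrow> right_equivariant N s x"
    and g: "g \<in> GL j" "j < N" and nz: "x (emb N j g) \<noteq> 0"
  shows "g \<in> Nuni j"
  using g nz
proof (induction j arbitrary: g)
  case 0
  thus ?case by (simp add: Nuni_iff)
next
  case (Suc j g)
  let ?j = "Suc j"
  have gc: "g \<in> carrier_mat ?j ?j" using Suc.prems by simp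
  have row: "row g j = lastv ?j"
  proof (rule ccontr)
    assume ne: "row g j \<noteq> lastv ?j"
    let ?c = "row g j - lastv ?j"
    have c: "?c \<in> carrier_vec ?j"
      by (intro carrier_vecI) (simp add: carrier_vecD[OF lastv_carrier])
    have "x (emb N ?j g) = 0"
    proof (rule eq_0_if_twisted[OF c])
      show "?c \<noteq> 0\<^sub>v ?j"
      proof
        assume "?c = 0\<^sub>v ?j"
        hence "row g j $ i - lastv ?j $ i = 0" if "i < ?j" for i
          using that gc by (metis index_minus_vec(1) index_zero_vec(1) lastv_carrier carrier_vecD)
        hence "row g j = lastv ?j" using gc by (intro eq_vecI) auto
        thus False using ne by simp
      qed
      fix z :: "'k vec" assume z: "z \<in> carrier_vec ?j"
      \<comment> \<open>The size of g is less than N, so the next radical still lies in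
        \<open>GL N\<close>.\<close>
      have re: "right_equivariant N (Suc ?j) x" using Suc.prems by (intro r) auto
      have "psi (lastv ?j \<bullet> z) * x (emb N ?j g) = rt N (uelt N (Suc ?j) z) x (emb N ?j g)"
        using re z by (simp add: right_equivariant_def)
      also have "\<dots> = x (uelt N (Suc ?j) (g *\<^sub>v z) * emb N ?j g)"
        using Suc.prems emb_uelt_commute[of "Suc ?j" N z g] z gc by (simp add: rt_def)
      also have "\<dots> = psi (lastv ?j \<bullet> (g *\<^sub>v z)) * x (emb N ?j g)"
        using Suc.prems left_equivariant_uelt[OF x, of "Suc ?j" "g *\<^sub>v z" "emb N ?j g"]
          mult_mat_vec_carrier[OF gc z] by simp
      also have "lastv ?j \<bullet> (g *\<^sub>v z) = row g j \<bullet> z"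
        using transpose_vec_mult_scalar[OF gc z lastv_carrier] transpose_mult_lastv[OF gc] by simp
      finally have eq: "psi (lastv ?j \<bullet> z) * x (emb N ?j g) = psi (row g j \<bullet> z) * x (emb N ?j g)" .
      have "x (emb N ?j g) = psi (- (lastv ?j \<bullet> z)) * (psi (lastv ?j \<bullet> z) * x (emb N ?j g))"
        by (simp flip: mult.assoc psi_add)
      also have "\<dots> = psi (- (lastv ?j \<bullet> z) + row g j \<bullet> z) * x (emb N ?j g)"
        unfolding eq by (simp only: psi_add mult.assoc)
      also have "- (lastv ?j \<bullet> z) + row g j \<bullet> z = ?c \<bullet> z"
        using gc z by (subst minus_scalar_prod_distrib[of _ ?j]) (auto intro!: carrier_vecI)
      finally show "x (emb N ?j g) = psi (?c \<bullet> z) * x (emb N ?j g)" .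
    qed
    thus False using Suc.prems by simp
  qed
  let ?y = "vec j (\<lambda>i. g $$ (i, j))" and ?h = "mat j j (\<lambda>x. g $$ x)"
  have dec: "g = umat ?j ?y * emb ?j j ?h" using last_row_decomp[OF gc] row by simp
  have "det (umat ?j ?y) * det (emb ?j j ?h) = det g"
    using det_mult[of "umat ?j ?y" ?j "emb ?j j ?h"] dec by simp
  hence h: "?h \<in> GL j" using Suc.prems(1) by (simp add: GL_iff_det det_umat det_emb del: GL_carrier)
  have "emb N ?j g = uelt N ?j ?y * emb N j ?h"
    by (subst dec) (use Suc.prems h in \<open>simp add: emb_mult emb_emb\<close>)
  hence "x (emb N ?j g) = psi (lastv j \<bullet> ?y) * x (emb N j ?h)"
    using left_equivariant_uelt[OF x, of ?j ?y "emb N j ?h"] Suc.prems h by simp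
  hence "x (emb N j ?h) \<noteq> 0" using Suc.prems by auto
  hence "?h \<in> Nuni j" using Suc.IH[OF h] Suc.prems by simp
  thus ?case using Nuni_emb_umat[of ?h ?j ?y] dec by simp
qed

lemma psiN_last_column:
  assumes "0 < j"
  shows "psiN psi j u = psi (lastv (j - 1) \<bullet> vec (j - 1) (\<lambda>i. u $$ (i, j - 1)))
    * psiN psi (j - 1) (mat (j - 1) (j - 1) (\<lambda>x. u $$ x))"
proof (cases "j = 1")
  case True
  thus ?thesis by (simp add: psiN_def scalar_prod_def)
next
  case False
  then obtain k where k: "j = Suc (Suc k)" using assms by (metis One_nat_def not0_implies_Suc not_less_zero)
  show ?thesis unfolding k psiN_def by (simp add: scalar_prod_lastv psi_add mult.commute flip: Suc_eq_plus1)
qed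

end

section \<open>Bilinear forms on function spaces\<close>

lemma bilinear_onD:
  assumes "bilinear_on A B F"
  shows "x1 \<in> A \<Longrightarrow> x2 \<in> A \<Longrightarrow> y \<in> B \<Longrightarrow> F (x1 + x2) y = F x1 y + F x2 y"
    and "x \<in> A \<Longrightarrow> y \<in> B \<Longrightarrow> F (fscale r x) y = r * F x y"
    and "x \<in> A \<Longrightarrow> y1 \<in> B \<Longrightarrow> y2 \<in> B \<Longrightarrow> F x (y1 + y2) = F x y1 + F x y2"
    and "x \<in> A \<Longrightarrow> y \<in> B \<Longrightarrow> F x (fscale r y) = r * F x y"
  using assms unfolding bilinear_on_def by blast+

lemma bilinear_on_zero:
  assumes F: "bilinear_on A B F" and AB: "fs.subspace A" "fs.subspace B"
  shows "y \<in> B \<Longrightarrow> F 0 y = 0" "x \<in> A \<Longrightarrow> F x 0 = 0"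
  using bilinear_onD(2)[OF F, of 0 y 0] bilinear_onD(4)[OF F, of x 0 0]
    fs.subspace_0[OF AB(1)] fs.subspace_0[OF AB(2)] fs.scale_zero_left
  by auto

lemma bilinear_on_sum_left:
  assumes F: "bilinear_on A B F" and AB: "fs.subspace A" "fs.subspace B"
    and f: "\<And>i. i \<in> I \<Longrightarrow> f i \<in> A" and y: "y \<in> B"
  shows "F (\<Sum>i\<in>I. f i) y = (\<Sum>i\<in>I. F (f i) y)"
  using f
proof (induction I rule: infinite_finite_induct)
  case (insert i I)
  have "F (f i + (\<Sum>i\<in>I. f i)) y = F (f i) y + F (\<Sum>i\<in>I. f i) y"
    by (rule bilinear_onD(1)[OF F]) (use insert.prems y in \<open>auto intro: fs.subspace_sum AB\<close>)
  moreover have "F (\<Sum>i\<in>I. f i) y = (\<Sum>i\<in>I. F (f i) y)" using insert by blast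
  ultimately show ?case by (simp only: sum.insert[OF insert.hyps])
next
  case (infinite I)
  show ?case unfolding sum.infinite[OF infinite(1)] by (rule bilinear_on_zero(1)[OF F AB y])
qed (simp only: sum.empty bilinear_on_zero(1)[OF F AB y])

lemma bilinear_on_sum_right:
  assumes F: "bilinear_on A B F" and AB: "fs.subspace A" "fs.subspace B"
    and f: "\<And>i. i \<in> I \<Longrightarrow> f i \<in> B" and x: "x \<in> A"
  shows "F x (\<Sum>i\<in>I. f i) = (\<Sum>i\<in>I. F x (f i))"
  using f
proof (induction I rule: infinite_finite_induct)
  case (insert i I)
  have "F x (f i + (\<Sum>i\<in>I. f i)) = F x (f i) + F x (\<Sum>i\<in>I. f i)"
    by (rule bilinear_onD(3)[OF F]) (use insert.prems x in \<open>auto intro: fs.subspace_sum AB\<close>)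
  moreover have "F x (\<Sum>i\<in>I. f i) = (\<Sum>i\<in>I. F x (f i))" using insert by blast
  ultimately show ?case by (simp only: sum.insert[OF insert.hyps])
next
  case (infinite I)
  show ?case unfolding sum.infinite[OF infinite(1)] by (rule bilinear_on_zero(2)[OF F AB x])
qed (simp only: sum.empty bilinear_on_zero(2)[OF F AB x])

section \<open>Kernels of the derivatives and the projectors\<close>

text \<open>Two instances occur: the identity of a Whittaker model, for the derivatives of the
  model, and the map from V onto its Whittaker model, for the kernel of the Whittaker
  functional.\<close>

locale intertwiner = additive_character psi for psi :: "'k::{field,finite} \<Rightarrow> 'r::comm_ring_1" +
  fixes sc :: "'r \<Rightarrow> 'v::ab_group_add \<Rightarrow> 'v" and act :: "'k mat \<Rightarrow> 'v \<Rightarrow> 'v" and Vs :: "'v set"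
    and N :: nat and \<phi> :: "'v \<Rightarrow> 'k mat \<Rightarrow> 'r"
  assumes sc_module: "Modules.module sc" and Vs_subspace: "Modules.module.subspace sc Vs"
    and act_in: "g \<in> GL N \<Longrightarrow> v \<in> Vs \<Longrightarrow> act g v \<in> Vs"
    and \<phi>_add: "v \<in> Vs \<Longrightarrow> w \<in> Vs \<Longrightarrow> \<phi> (v + w) = \<phi> v + \<phi> w"
    and \<phi>_scale: "v \<in> Vs \<Longrightarrow> \<phi> (sc r v) = fscale r (\<phi> v)"
    and \<phi>_act: "g \<in> GL N \<Longrightarrow> v \<in> Vs \<Longrightarrow> \<phi> (act g v) = rt N g (\<phi> v)"
begin

sublocale M: Modules.module sc by (rule sc_module)

lemma \<phi>_diff: "v \<in> Vs \<Longrightarrow> w \<in> Vs \<Longrightarrow> \<phi> (v - w) = \<phi> v - \<phi> w"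
  using \<phi>_add[of "v - w" w] M.subspace_diff[OF Vs_subspace, of v w] by (simp add: algebra_simps)

lemma \<phi>_zero: "\<phi> 0 = 0"
  using \<phi>_diff[of 0 0] M.subspace_0[OF Vs_subspace] by simp

lemma kernel_subspace:
  assumes T: "\<And>x y. T (x + y) = T x + T y" "\<And>r x. T (fscale r x) = fscale r (T x)"
  shows "M.subspace {v \<in> Vs. T (\<phi> v) = 0}"
proof (rule M.subspaceI)
  have "T (fscale 0 0) = fscale 0 (T 0)" by (rule T(2))
  hence "T 0 = 0" by (simp only: fs.scale_zero_left)
  thus "0 \<in> {v \<in> Vs. T (\<phi> v) = 0}" using M.subspace_0[OF Vs_subspace] by (simp only: \<phi>_zero mem_Collect_eq)
next
  fix x y assume "x \<in> {v \<in> Vs. T (\<phi> v) = 0}" "y \<in> {v \<in> Vs. T (\<phi> v) = 0}"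
  thus "x + y \<in> {v \<in> Vs. T (\<phi> v) = 0}"
    using M.subspace_add[OF Vs_subspace, of x y] by (simp add: \<phi>_add T del: plus_fun_apply)
next
  fix c x assume "x \<in> {v \<in> Vs. T (\<phi> v) = 0}"
  thus "sc c x \<in> {v \<in> Vs. T (\<phi> v) = 0}"
    using M.subspace_scale[OF Vs_subspace, of x c]
    by (simp only: \<phi>_scale T mem_Collect_eq fs.scale_zero_right)
qed

text \<open>The relations added at stage i + 1 compare translation by U_(N-i) with psi, and
  \<open>Q N (Suc i)\<close> turns this translation into psi. Thus \<open>Q\<close> factors through
  the powers of Phi^-.\<close>

lemma Q_phi_ker:
  assumes "i \<le> N" "v \<in> phi_ker sc act Vs psi N i"
  shows "v \<in> Vs \<and> Q N i (\<phi> v) = 0"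
  using assms
proof (induction i arbitrary: v)
  case 0
  thus ?case using M.subspace_0[OF Vs_subspace] \<phi>_zero by simp
next
  case (Suc i)
  let ?K = "{v \<in> Vs. Q N (Suc i) (\<phi> v) = 0}"
  let ?s = "N - i"
  have s: "0 < ?s" "?s \<le> N" using Suc.prems by auto
  have gen: "act (emb N ?s u) w - sc (psiN psi ?s u) w \<in> ?K" if u: "u \<in> Umir ?s" and w: "w \<in> Vs" for u w
  proof -
    obtain y where y: "u = umat ?s y" "y \<in> carrier_vec (?s - 1)" using u Umir_eq_range_umat[OF s(1)] by auto
    have g: "emb N ?s u \<in> GL N" using y s by simp
    have "\<phi> (act (emb N ?s u) w - sc (psiN psi ?s u) w)
      = rt N (uelt N ?s y) (\<phi> w) - fscale (psi (lastv (?s - 1) \<bullet> y)) (\<phi> w)"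
      using act_in[OF g w] M.subspace_scale[OF Vs_subspace w] g w y s
      by (simp only: \<phi>_diff \<phi>_act \<phi>_scale psiN_umat)
    hence "Q N (Suc i) (\<phi> (act (emb N ?s u) w - sc (psiN psi ?s u) w)) = 0"
      using Q_Suc_rt_uelt[of i N y "\<phi> w"] Suc.prems y(2)
      by (simp only: Q_diff Q_fscale Suc_le_eq diff_self)
    thus ?thesis
      using M.subspace_diff[OF Vs_subspace act_in[OF g w] M.subspace_scale[OF Vs_subspace w]] by blast
  qed
  have old: "w \<in> ?K" if "w \<in> phi_ker sc act Vs psi N i" for w
    using Suc.IH[OF _ that] Suc.prems by (simp only: Q.simps pr_zero mem_Collect_eq)
  have "M.span (phi_ker sc act Vs psi N i \<union>
     {act (emb N ?s u) v - sc (psiN psi ?s u) v | u v. u \<in> Umir ?s \<and> v \<in> Vs}) \<subseteq> ?K"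
    using gen old by (intro M.span_minimal kernel_subspace Q_add Q_fscale) blast
  thus ?case using Suc.prems by auto
qed

text \<open>Psi^- corresponds to the projector for the trivial character; after k - 1 steps of Phi^-
  the group in turn is U_(N-k+1).\<close>

lemma pr_deriv_ker:
  assumes k: "0 < k" "k \<le> N" and v: "v \<in> deriv_ker sc act Vs psi N k"
  shows "v \<in> Vs \<and> pr N (N - (k - 1)) (0\<^sub>v (N - (k - 1) - 1)) (Q N (k - 1) (\<phi> v)) = 0"
proof -
  let ?s = "N - (k - 1)"
  let ?T = "\<lambda>x. pr N ?s (0\<^sub>v (?s - 1)) (Q N (k - 1) x)"
  let ?K = "{v \<in> Vs. ?T (\<phi> v) = 0}"
  have s: "0 < ?s" "?s \<le> N" using k by auto
  have gen: "act (emb N ?s u) w - w \<in> ?K" if u: "u \<in> Umir ?s" and w: "w \<in> Vs" for u w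
  proof -
    obtain y where y: "u = umat ?s y" "y \<in> carrier_vec (?s - 1)" using u Umir_eq_range_umat[OF s(1)] by auto
    have g: "emb N ?s u \<in> GL N" using y s by simp
    have \<phi>: "\<phi> (act (emb N ?s u) w - w) = rt N (uelt N ?s y) (\<phi> w) - \<phi> w"
      using act_in[OF g w] g w y s by (simp only: \<phi>_diff \<phi>_act)
    have "Q N (k - 1) (rt N (uelt N ?s y) (\<phi> w)) = rt N (uelt N ?s y) (Q N (k - 1) (\<phi> w))"
      using k s row_umat_last[of ?s y] by (intro Q_rt_emb) auto
    moreover have "pr N ?s (0\<^sub>v (?s - 1)) (rt N (uelt N ?s y) (Q N (k - 1) (\<phi> w)))
      = fscale (psi (0\<^sub>v (?s - 1) \<bullet> y)) (?T (\<phi> w))"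
      by (rule pr_rt_uelt) (use s y in auto)
    ultimately have "?T (\<phi> (act (emb N ?s u) w - w)) = 0"
      using y(2) unfolding \<phi> Q_diff pr_diff
      by (simp only: scalar_prod_left_zero psi_0 fs.scale_one diff_self)
    thus ?thesis
      using M.subspace_diff[OF Vs_subspace act_in[OF g w] w] by blast
  qed
  have old: "w \<in> ?K" if "w \<in> phi_ker sc act Vs psi N (k - 1)" for w
    using Q_phi_ker[OF _ that] k by (simp only: pr_zero mem_Collect_eq)
  have "M.span (phi_ker sc act Vs psi N (k - 1) \<union>
     {act (emb N ?s u) v - v | u v. u \<in> Umir ?s \<and> v \<in> Vs}) \<subseteq> ?K"
    using gen old by (intro M.span_minimal kernel_subspace) (auto simp only: Q_add pr_add Q_fscale pr_fscale)
  thus ?thesis using v k unfolding deriv_ker_def by auto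
qed

lemma Q_deriv_ker_top:
  assumes N: "0 < N" and v: "v \<in> deriv_ker sc act Vs psi N N" and van: "\<And>g. g \<notin> GL N \<Longrightarrow> \<phi> v g = 0"
  shows "Q N (N - 1) (\<phi> v) = 0"
proof -
  have z: "Q N i (\<phi> v) g = 0" if "g \<notin> GL N" for g i
    using van[OF that] that by (cases i) (simp_all add: pr_apply)
  have "carrier_vec 0 = {0\<^sub>v 0 :: 'k vec}" by auto
  hence "pr N 1 (0\<^sub>v 0) (Q N (N - 1) (\<phi> v)) = Q N (N - 1) (\<phi> v)"
    using sum_pr[of 1 N "Q N (N - 1) (\<phi> v)"] N z by simp
  thus ?thesis using pr_deriv_ker[OF N le_refl v] N by simp
qed

end

section \<open>The action of GL_(j-1) on the components for U_j\<close>

context additive_character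
begin

lemma pr_deriv_ker_self:
  assumes W: "invariant_space N W" and t: "t < N" and x: "x \<in> deriv_ker fscale (rt N) W psi N (N - t)"
  shows "pr N (Suc t) (0\<^sub>v t) (Q N (N - Suc t) x) = 0"
proof -
  interpret intertwiner psi fscale "rt N" W N "\<lambda>x. x"
    by unfold_locales (use invariant_spaceD[OF W] in auto)
  have "N - (N - t - 1) = Suc t" "N - t - 1 = N - Suc t" "Suc t - 1 = t" using t by auto
  thus ?thesis using pr_deriv_ker[OF _ _ x] t by (metis diff_le_self zero_less_diff)
qed

text \<open>The transpose of g sends \<open>lastv\<close> to c, so translation by g carries the
  c-component for U_j to the psi-component, which is the next stage of \<open>Q\<close>.\<close>

lemma rt_pr_Q:
  assumes j: "1 < j" "j \<le> N" and g: "g \<in> GL (j - 1)" "row g (j - 1 - 1) = c"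
  shows "rt N (emb N (j - 1) g) (pr N j c (Q N (N - j) x)) = Q N (N - (j - 1)) (rt N (emb N (j - 1) g) x)"
proof -
  have e: "N - (j - 1) = Suc (N - j)" "N - (N - j) = j" using j by auto
  have "transpose_mat g *\<^sub>v lastv (j - 1) = c" using transpose_mult_lastv[of g "j - 1"] g by simp
  moreover have "pr N j (lastv (j - 1)) (rt N (emb N (j - 1) g) (Q N (N - j) x))
    = rt N (emb N (j - 1) g) (pr N j (transpose_mat g *\<^sub>v lastv (j - 1)) (Q N (N - j) x))"
    by (rule pr_rt_emb) (use j g in auto)
  moreover have "Q N (N - j) (rt N (emb N (j - 1) g) x) = rt N (emb N (j - 1) g) (Q N (N - j) x)"
    using j g by (intro Q_rt_emb) auto
  ultimately show ?thesis unfolding e Q.simps by (simp only:)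
qed

text \<open>The trivial character is fixed by all of \<open>GL (j - 1)\<close>. This supplies the
  invariance demanded of an exceptional form.\<close>

lemma pr_zero_Q_rt_emb:
  assumes j: "1 < j" "j \<le> N" and g: "g \<in> GL (j - 1)"
  shows "pr N j (0\<^sub>v (j - 1)) (Q N (N - j) (rt N (emb N (j - 1) g) x))
    = rt N (emb N (j - 1) g) (pr N j (0\<^sub>v (j - 1)) (Q N (N - j) x))"
proof -
  have "transpose_mat g *\<^sub>v 0\<^sub>v (j - 1) = 0\<^sub>v (j - 1)"
    using carrier_matD[OF GL_carrier[OF g]] by (intro eq_vecI) (auto simp: scalar_prod_def)
  moreover have "pr N j (0\<^sub>v (j - 1)) (rt N (emb N (j - 1) g) (Q N (N - j) x))
    = rt N (emb N (j - 1) g) (pr N j (transpose_mat g *\<^sub>v 0\<^sub>v (j - 1)) (Q N (N - j) x))"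
    by (rule pr_rt_emb) (use j g in auto)
  moreover have "Q N (N - j) (rt N (emb N (j - 1) g) x) = rt N (emb N (j - 1) g) (Q N (N - j) x)"
    using j g by (intro Q_rt_emb) auto
  ultimately show ?thesis by (simp only:)
qed

end

section \<open>Vanishing of equivariant forms\<close>

locale whittaker_pair = additive_character psi for psi :: "'k::{field,finite} \<Rightarrow> 'r::comm_ring_1" +
  fixes n m :: nat and W W' :: "('k mat \<Rightarrow> 'r) set"
  assumes mn: "1 \<le> m" "m < n"
    and W: "invariant_space n W" and W': "invariant_space m W'"
    and left_W: "x \<in> W \<Longrightarrow> left_equivariant n x"
    and left_W': "y \<in> W' \<Longrightarrow> additive_character.left_equivariant (\<lambda>a. psi (- a)) m y"
begin

sublocale inv: additive_character "\<lambda>a. psi (- a)"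
  by (rule inverse_character)

lemmas sub = invariant_spaceD(1)[OF W] invariant_spaceD(1)[OF W']

context
  fixes F
  assumes F: "H_equivariant psi n m W W' F"
begin

lemma F_bilinear: "bilinear_on W W' F"
  using F by (simp add: H_equivariant_def)

lemma F_invariant:
  assumes "j \<le> m" "g \<in> GL j" "x \<in> W" "y \<in> W'"
  shows "F (rt n (emb n j g) x) (rt m (emb m j g) y) = F x y"
proof -
  have h: "emb m j g \<in> GL m" using assms by simp
  have "F (rt n (emb n m (emb m j g) * 1\<^sub>m n) x) (rt m (emb m j g) y) = psiN psi n (1\<^sub>m n) * F x y"
    using F h assms Uhn_one unfolding H_equivariant_def by blast
  moreover have "emb n m (emb m j g) * 1\<^sub>m n = emb n j g"
    using mn assms by (simp add: emb_emb right_mult_one_mat[of _ n n])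
  ultimately show ?thesis by (simp add: psiN_one)
qed

lemma F_Uhn:
  assumes "u \<in> Uhn n m" "x \<in> W" "y \<in> W'"
  shows "F (rt n u x) y = psiN psi n u * F x y"
proof -
  have "F (rt n (emb n m (1\<^sub>m m) * u) x) (rt m (1\<^sub>m m) y) = psiN psi n u * F x y"
    using F GL_one assms unfolding H_equivariant_def by blast
  moreover have "emb n m (1\<^sub>m m) * u = u"
    using mn Nuni_carrier[OF Uhn_Nuni[OF assms(1)]] by simp
  moreover have "rt m (1\<^sub>m m) y = y"
    using invariant_spaceD(3)[OF W' assms(3)] by (rule rt_one)
  ultimately show ?thesis by simp
qed

text \<open>U_j lies in G_m and leaves F invariant, yet on this pair of components it acts through
  psi ((c - c') . z); the minus sign comes from the inverse character on \<open>W'\<close>.\<close>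

lemma F_twisted_pr_off_diagonal:
  assumes j: "0 < j" "j \<le> m" and c: "c \<in> carrier_vec (j - 1)" "c' \<in> carrier_vec (j - 1)" "c \<noteq> c'"
    and x: "x \<in> W" and y: "y \<in> W'"
  shows "F (pr n j c x) (inv.pr m j c' y) = 0"
proof (rule eq_0_if_twisted)
  let ?x = "pr n j c x" and ?y = "inv.pr m j c' y"
  have jn: "j \<le> n" using j mn by simp
  have X: "?x \<in> W" by (rule pr_in[OF W x j(1) jn])
  have Y: "?y \<in> W'" by (rule inv.pr_in[OF W' y j])
  show "c - c' \<in> carrier_vec (j - 1)" using c by simp
  show "c - c' \<noteq> 0\<^sub>v (j - 1)"
  proof
    assume eq: "c - c' = 0\<^sub>v (j - 1)"
    have "c $ i = c' $ i" if "i < j - 1" for i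
      using arg_cong[OF eq, of "\<lambda>v. v $ i"] that c by simp
    hence "c = c'" using c by (intro eq_vecI) auto
    thus False using c by simp
  qed
  fix z :: "'k vec" assume z: "z \<in> carrier_vec (j - 1)"
  have "F ?x ?y = F (rt n (uelt n j z) ?x) (rt m (uelt m j z) ?y)"
    using F_invariant[OF j(2) umat_GL[OF j(1)] X Y] by simp
  also have "\<dots> = F (fscale (psi (c \<bullet> z)) ?x) (fscale (psi (- (c' \<bullet> z))) ?y)"
    by (simp only: rt_uelt_pr[OF j(1) jn c(1) z] inv.rt_uelt_pr[OF j c(2) z])
  also have "\<dots> = psi (c \<bullet> z) * (psi (- (c' \<bullet> z)) * F ?x ?y)"
    using X Y fs.subspace_scale[OF sub(2) Y]
    by (simp only: bilinear_onD[OF F_bilinear])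
  also have "\<dots> = psi (c \<bullet> z + - (c' \<bullet> z)) * F ?x ?y" by (simp only: psi_add mult.assoc)
  also have "c \<bullet> z + - (c' \<bullet> z) = (c - c') \<bullet> z"
    using c z by (subst minus_scalar_prod_distrib[of _ "j - 1"]) auto
  finally show "F ?x ?y = psi ((c - c') \<bullet> z) * F ?x ?y" .
qed

text \<open>For s \<ge> m + 2 the form is psi-equivariant in x under U_s, so all terms of the
  average equal \<open>F x y\<close>. The bound on i stops the product at U_(m+2).\<close>

lemma F_Q_left:
  assumes "i \<le> n - m - 1" "x \<in> W" "y \<in> W'"
  shows "F (Q n i x) y = F x y"
  using assms(1)
proof (induction i)
  case (Suc i)
  let ?s = "n - i"
  let ?X = "Q n i x"
  have X: "?X \<in> W" using Suc.prems assms by (intro Q_in[OF W]) auto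
  have s: "m + 2 \<le> ?s" "?s \<le> n" "0 < ?s" using Suc.prems by auto
  have rW: "rt n (uelt n ?s z) ?X \<in> W" for z
    using s by (intro invariant_spaceD(2)[OF W _ X]) simp
  have "F (Q n (Suc i) x) y = card_inv (?s - 1) *
    (\<Sum>z\<in>carrier_vec (?s - 1). psi (- (lastv (?s - 1) \<bullet> z)) * F (rt n (uelt n ?s z) ?X) y)"
    unfolding Q.simps pr_def using rW assms(3)
    by (simp only: bilinear_onD(2)[OF F_bilinear] bilinear_on_sum_left[OF F_bilinear sub]
        fs.subspace_sum[OF sub(1)] fs.subspace_scale[OF sub(1)])
  also have "(\<Sum>z\<in>carrier_vec (?s - 1). psi (- (lastv (?s - 1) \<bullet> z)) * F (rt n (uelt n ?s z) ?X) y)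
    = (\<Sum>z\<in>(carrier_vec (?s - 1) :: 'k vec set). F ?X y)"
  proof (rule sum.cong[OF refl])
    fix z :: "'k vec" assume z: "z \<in> carrier_vec (?s - 1)"
    have "F (rt n (uelt n ?s z) ?X) y = psi (lastv (?s - 1) \<bullet> z) * F ?X y"
      using F_Uhn[OF emb_umat_Uhn[OF s(1,2)] X assms(3)] s z by (simp add: psiN_emb psiN_umat)
    thus "psi (- (lastv (?s - 1) \<bullet> z)) * F (rt n (uelt n ?s z) ?X) y = F ?X y"
      by (simp flip: mult.assoc psi_add)
  qed
  also have "card_inv (?s - 1) * \<dots> = F ?X y"
    by (simp add: card_carrier_vec card_inv flip: mult.assoc)
  finally show ?case using Suc by simp
qed simp

text \<open>P and P' stand for projections that factor through the derivatives of orders n - t and m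
  - t. A nonzero value of F composed with them would give an exceptional form.\<close>

lemma F_eq_0_if_not_exceptional:
  assumes exc: "\<not> exceptional psi n m W W'" and t: "1 \<le> t" "t \<le> m"
    and P: "\<And>x. x \<in> W \<Longrightarrow> P x \<in> W" "\<And>x y. P (x + y) = P x + P y" "\<And>r x. P (fscale r x) = fscale r (P x)"
      "\<And>x. x \<in> deriv_ker fscale (rt n) W psi n (n - t) \<Longrightarrow> P x = 0"
      "\<And>g x. g \<in> GL t \<Longrightarrow> P (rt n (emb n t g) x) = rt n (emb n t g) (P x)"
    and P': "\<And>x. x \<in> W' \<Longrightarrow> P' x \<in> W'" "\<And>x y. P' (x + y) = P' x + P' y" "\<And>r x. P' (fscale r x) = fscale r (P' x)"
      "\<And>x. x \<in> deriv_ker fscale (rt m) W' (\<lambda>a. psi (- a)) m (m - t) \<Longrightarrow> P' x = 0"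
      "\<And>g x. g \<in> GL t \<Longrightarrow> P' (rt m (emb m t g) x) = rt m (emb m t g) (P' x)"
    and xy: "x \<in> W" "y \<in> W'"
  shows "F (P x) (P' y) = 0"
proof (rule ccontr)
  assume nz: "F (P x) (P' y) \<noteq> 0"
  let ?F = "\<lambda>x y. F (P x) (P' y)"
  have "bilinear_on W W' ?F"
    unfolding bilinear_on_def
    by (intro conjI ballI allI; simp only: P(2,3) P'(2,3); rule bilinear_onD[OF F_bilinear]; intro P(1) P'(1))
  moreover have "\<forall>x\<in>deriv_ker fscale (rt n) W psi n (n - t). \<forall>y\<in>W'. ?F x y = 0"
    by (intro ballI) (simp only: P(4) P'(1) bilinear_on_zero[OF F_bilinear sub])
  moreover have "\<forall>x\<in>W. \<forall>y\<in>deriv_ker fscale (rt m) W' (\<lambda>a. psi (- a)) m (m - t). ?F x y = 0"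
    by (intro ballI) (simp only: P'(4) P(1) bilinear_on_zero[OF F_bilinear sub])
  moreover have "\<forall>g\<in>GL t. \<forall>x\<in>W. \<forall>y\<in>W'. ?F (rt n (emb n t g) x) (rt m (emb m t g) y) = ?F x y"
    by (intro ballI) (simp only: P(1,5) P'(1,5) F_invariant[OF t(2)])
  ultimately have "exceptional psi n m W W'"
    unfolding exceptional_def using t xy nz
    by (intro bexI[of _ t] exI[of _ ?F] conjI) auto
  thus False using exc by simp
qed

text \<open>The trivial components for U_j factor through the derivatives with t = j - 1; the bound
  j > 1 gives t \<ge> 1.\<close>

lemma F_pr_zero_eq_0:
  assumes exc: "\<not> exceptional psi n m W W'" and j: "1 < j" "j \<le> m" and xy: "x \<in> W" "y \<in> W'"
  shows "F (pr n j (0\<^sub>v (j - 1)) (Q n (n - j) x)) (inv.pr m j (0\<^sub>v (j - 1)) (inv.Q m (m - j) y)) = 0"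
proof (rule F_eq_0_if_not_exceptional[OF exc, where t = "j - 1" and P = "\<lambda>x. pr n j (0\<^sub>v (j - 1)) (Q n (n - j) x)"
    and P' = "\<lambda>y. inv.pr m j (0\<^sub>v (j - 1)) (inv.Q m (m - j) y)"])
  have jn: "j \<le> n" using j mn by simp
  show "x \<in> deriv_ker fscale (rt n) W psi n (n - (j - 1)) \<Longrightarrow> pr n j (0\<^sub>v (j - 1)) (Q n (n - j) x) = 0" for x
    using pr_deriv_ker_self[OF W, of "j - 1" x] j jn by simp
  show "y \<in> deriv_ker fscale (rt m) W' (\<lambda>a. psi (- a)) m (m - (j - 1)) \<Longrightarrow>
      inv.pr m j (0\<^sub>v (j - 1)) (inv.Q m (m - j) y) = 0" for y
    using inv.pr_deriv_ker_self[OF W', of "j - 1" y] j jn by simp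
qed (use j mn in \<open>simp_all only: pr_add Q_add inv.pr_add inv.Q_add pr_fscale Q_fscale inv.pr_fscale
  inv.Q_fscale pr_zero_Q_rt_emb inv.pr_zero_Q_rt_emb\<close>,
  use j mn xy in \<open>auto intro!: pr_in[OF W] Q_in[OF W] inv.pr_in[OF W'] inv.Q_in[OF W']\<close>)

lemma F_descent:
  assumes exc: "\<not> exceptional psi n m W W'" and j: "1 < j" "j \<le> m"
    and IH: "\<And>x y. x \<in> W \<Longrightarrow> y \<in> W' \<Longrightarrow> F (Q n (n - (j - 1)) x) (inv.Q m (m - (j - 1)) y) = 0"
    and xy: "x \<in> W" "y \<in> W'"
  shows "F (Q n (n - j) x) (inv.Q m (m - j) y) = 0"
proof -
  let ?X = "Q n (n - j) x" and ?Y = "inv.Q m (m - j) y" and ?V = "carrier_vec (j - 1) :: 'k vec set"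
  have jn: "0 < j" "j \<le> n" using j mn by auto
  have X: "?X \<in> W" using xy by (intro Q_in[OF W]) auto
  have Y: "?Y \<in> W'" using xy by (intro inv.Q_in[OF W']) auto
  have pX: "pr n j c ?X \<in> W" for c by (rule pr_in[OF W X jn])
  have pY: "inv.pr m j c ?Y \<in> W'" for c by (rule inv.pr_in[OF W' Y jn(1) j(2)])
  have zero: "F (pr n j c ?X) (inv.pr m j c' ?Y) = 0" if c: "c \<in> ?V" "c' \<in> ?V" for c c'
  proof (cases "c = c'")
    case False
    thus ?thesis using F_twisted_pr_off_diagonal[OF jn(1) j(2) c _ X Y] by simp
  next
    case eq: True
    show ?thesis
    proof (cases "c = 0\<^sub>v (j - 1)")
      case True
      thus ?thesis using F_pr_zero_eq_0[OF exc j xy] eq by simp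
    next
      case False
      \<comment> \<open>Translation by g moves both components at once to those for psi and its
        inverse, where the hypothesis for j - 1 applies to the translates of x and y.\<close>
      obtain g where g: "g \<in> GL (j - 1)" "row g (j - 1 - 1) = c"
        using exists_GL_last_row[OF c(1) False] by metis
      have "F (pr n j c ?X) (inv.pr m j c ?Y)
        = F (rt n (emb n (j - 1) g) (pr n j c ?X)) (rt m (emb m (j - 1) g) (inv.pr m j c ?Y))"
        by (rule F_invariant[symmetric]) (use j g pX pY in auto)
      also have "\<dots> = F (Q n (n - (j - 1)) (rt n (emb n (j - 1) g) x)) (inv.Q m (m - (j - 1)) (rt m (emb m (j - 1) g) y))"
        by (simp only: rt_pr_Q[OF j(1) jn(2) g] inv.rt_pr_Q[OF j g])
      also have "\<dots> = 0"
        using g j jn by (intro IH invariant_spaceD(2)[OF W _ xy(1)] invariant_spaceD(2)[OF W' _ xy(2)]) auto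
      finally show ?thesis using eq by simp
    qed
  qed
  have "F ?X ?Y = F (\<Sum>c\<in>?V. pr n j c ?X) (\<Sum>c\<in>?V. inv.pr m j c ?Y)"
  proof -
    have "(\<Sum>c\<in>?V. pr n j c ?X) = ?X" by (rule sum_pr[OF jn]) (rule invariant_spaceD(3)[OF W X])
    moreover have "(\<Sum>c\<in>?V. inv.pr m j c ?Y) = ?Y"
      by (rule inv.sum_pr[OF jn(1) j(2)]) (rule invariant_spaceD(3)[OF W' Y])
    ultimately show ?thesis by (simp only:)
  qed
  also have "\<dots> = (\<Sum>c\<in>?V. \<Sum>c'\<in>?V. F (pr n j c ?X) (inv.pr m j c' ?Y))"
    using pX pY fs.subspace_sum[OF sub(2), of ?V "\<lambda>c. inv.pr m j c ?Y"]
    by (simp only: bilinear_on_sum_left[OF F_bilinear sub] bilinear_on_sum_right[OF F_bilinear sub])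
  also have "\<dots> = 0" using zero by (intro sum.neutral ballI) auto
  finally show ?thesis .
qed

text \<open>Vanishing climbs from j = 1 to j = m in both variables. The further step to U_(m+1)
  concerns x alone, since this group does not act on \<open>W'\<close>: each Fourier component of x
  is shown to vanish against the unprojected y.\<close>

lemma F_eq_0_if_Q_eq_0:
  assumes exc: "\<not> exceptional psi n m W W'"
    and F1: "\<And>x y. x \<in> W \<Longrightarrow> y \<in> W' \<Longrightarrow> F (Q n (n - 1) x) (inv.Q m (m - 1) y) = 0"
    and xy: "x \<in> W" "y \<in> W'"
  shows "F x y = 0"
proof -
  have C: "\<forall>x\<in>W. \<forall>y\<in>W'. F (Q n (n - j) x) (inv.Q m (m - j) y) = 0" if "1 \<le> j" "j \<le> m" for j
    using that
  proof (induction j rule: nat_induct_at_least)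
    case base
    thus ?case using F1 by blast
  next
    case (Suc j)
    thus ?case using F_descent[OF exc, of "Suc j"] by (intro ballI) auto
  qed
  let ?j = "Suc m" and ?V = "carrier_vec m :: 'k vec set"
  let ?X = "Q n (n - ?j) x"
  have jn: "0 < ?j" "?j \<le> n" "1 < ?j" using mn by auto
  have X: "?X \<in> W" using xy by (intro Q_in[OF W]) auto
  have pX: "pr n ?j c ?X \<in> W" for c by (rule pr_in[OF W X jn(1,2)])
  have zero: "F (pr n ?j c ?X) y = 0" if c: "c \<in> ?V" for c
  proof (cases "c = 0\<^sub>v m")
    case True
    have "F (pr n ?j (0\<^sub>v m) (Q n (n - ?j) x)) y = 0"
    \<comment> \<open>For t = m the derivative of \<open>W'\<close> has order 0, so its projection
      is the identity.\<close>
    proof (rule F_eq_0_if_not_exceptional[OF exc, where t = m and P = "\<lambda>x. pr n ?j (0\<^sub>v m) (Q n (n - ?j) x)" and P' = "\<lambda>y. y"])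
      show "x \<in> deriv_ker fscale (rt n) W psi n (n - m) \<Longrightarrow> pr n ?j (0\<^sub>v m) (Q n (n - ?j) x) = 0" for x
        using pr_deriv_ker_self[OF W, of m x] mn by simp
      show "y \<in> deriv_ker fscale (rt m) W' (\<lambda>a. psi (- a)) m (m - m) \<Longrightarrow> y = 0" for y
        by (simp add: deriv_ker_def)
      show "g \<in> GL m \<Longrightarrow> pr n ?j (0\<^sub>v m) (Q n (n - ?j) (rt n (emb n m g) x)) =
        rt n (emb n m g) (pr n ?j (0\<^sub>v m) (Q n (n - ?j) x))" for g x
        using pr_zero_Q_rt_emb[of ?j n g x] mn by simp
    qed (use xy mn in \<open>simp_all only: pr_add Q_add pr_fscale Q_fscale\<close>,
      use mn in \<open>auto intro!: pr_in[OF W] Q_in[OF W]\<close>)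
    thus ?thesis using True by simp
  next
    case False
    obtain g where g: "g \<in> GL m" "row g (m - 1) = c"
      using exists_GL_last_row[OF c False] by metis
    have gm: "emb m m g = g" using g by simp
    have gy: "rt m g y \<in> W'" by (rule invariant_spaceD(2)[OF W' g(1) xy(2)])
    have gx: "rt n (emb n m g) x \<in> W" using g mn by (intro invariant_spaceD(2)[OF W _ xy(1)]) auto
    have "F (pr n ?j c ?X) y = F (rt n (emb n m g) (pr n ?j c ?X)) (rt m g y)"
      using F_invariant[OF le_refl g(1) pX xy(2)] gm by simp
    also have "rt n (emb n m g) (pr n ?j c ?X) = Q n (n - m) (rt n (emb n m g) x)"
      using rt_pr_Q[OF jn(3,2), of g c x] g by simp
    also have "F (Q n (n - m) (rt n (emb n m g) x)) (rt m g y) = 0"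
      using C[of m] mn gx gy by (metis diff_self_eq_0 inv.Q.simps(1) le_refl)
    finally show ?thesis .
  qed
  \<comment> \<open>\<open>?X\<close> involves the projectors for U_n down to U_(m+2), exactly the
    range in which F absorbs them.\<close>
  have "F x y = F ?X y" using F_Q_left[of "n - ?j" x y] xy by simp
  also have "\<dots> = F (\<Sum>c\<in>?V. pr n ?j c ?X) y"
  proof -
    have "(\<Sum>c\<in>carrier_vec (?j - 1). pr n ?j c ?X) = ?X"
      by (rule sum_pr[OF jn(1,2)]) (rule invariant_spaceD(3)[OF W X])
    thus ?thesis by (simp only: diff_Suc_1)
  qed
  also have "\<dots> = (\<Sum>c\<in>?V. F (pr n ?j c ?X) y)"
    using pX xy by (simp only: bilinear_on_sum_left[OF F_bilinear sub])
  also have "\<dots> = 0" using zero by (intro sum.neutral ballI) auto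
  finally show ?thesis .
qed

end

end

section \<open>The Rankin-Selberg sum\<close>

context whittaker_pair
begin

abbreviation cosets :: "'k mat set set" where
  "cosets \<equiv> (\<lambda>g. {u * g | u. u \<in> Nuni m}) ` GL m"

text \<open>The factors psi u from x and its inverse from y cancel, so the representatives picked by
  \<open>SOME\<close> in the sum do not matter.\<close>

lemma integrand_left_invariant:
  assumes x: "left_equivariant n x" and y: "inv.left_equivariant m y" and u: "u \<in> Nuni m" and g: "g \<in> GL m"
  shows "x (emb n m (u * g)) * y (u * g) = x (emb n m g) * y g"
proof -
  have uc: "u \<in> carrier_mat m m" using u by (rule Nuni_carrier)
  have "x (emb n m (u * g)) = psiN psi m u * x (emb n m g)"
    using x u g mn uc emb_Nuni[of m n u] by (simp add: emb_mult left_equivariant_def psiN_emb)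
  moreover have "y (u * g) = psiN (\<lambda>a. psi (- a)) m u * y g"
    using y u g by (simp add: inv.left_equivariant_def)
  moreover have "psiN psi m u * psiN (\<lambda>a. psi (- a)) m u = 1"
    unfolding psiN_def by (rule psi_minus)
  ultimately show ?thesis by (metis mult.assoc mult.left_commute mult_1)
qed

lemma integrand_coset_rep:
  assumes x: "left_equivariant n x" and y: "inv.left_equivariant m y" and g: "g \<in> GL m"
    and h: "h \<in> {u * g | u. u \<in> Nuni m}"
  shows "x (emb n m h) * y h = x (emb n m g) * y g"
  using integrand_left_invariant[OF x y _ g] h by auto

lemma coset_rep: "g \<in> GL m \<Longrightarrow> (SOME h. h \<in> {u * g | u. u \<in> Nuni m}) \<in> {u * g | u. u \<in> Nuni m}"
  by (rule someI_ex) (use Nuni_one in blast)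

lemma coset_rep_GL:
  assumes "C \<in> cosets"
  shows "(SOME h. h \<in> C) \<in> GL m"
proof -
  obtain g where g: "g \<in> GL m" "C = {u * g | u. u \<in> Nuni m}" using assms by auto
  obtain u where "u \<in> Nuni m" "(SOME h. h \<in> C) = u * g" using coset_rep[OF g(1)] g(2) by blast
  thus ?thesis using g(1) Nuni_GL[of u m] by simp
qed

lemma coset_translate:
  assumes g: "g \<in> GL m" and h: "h \<in> GL m"
  shows "(\<lambda>a. a * h) ` {u * g | u. u \<in> Nuni m} = {u * (g * h) | u. u \<in> Nuni m}"
proof -
  have "u * g * h = u * (g * h)" if "u \<in> Nuni m" for u
    using that g h by (intro assoc_mult_mat[of _ m m _ m _ m]) (auto simp: Nuni_carrier)
  thus ?thesis by (auto simp: image_def)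
qed

text \<open>Right multiplication by h permutes the cosets; the translated representative of C and
  the chosen representative of the translated coset lie in one coset, where the integrand is
  constant.\<close>

lemma rs_integral_translate:
  assumes x: "left_equivariant n x" and y: "inv.left_equivariant m y" and h: "h \<in> GL m"
  shows "(\<Sum>C\<in>cosets. x (emb n m ((SOME g. g \<in> C) * h)) * y ((SOME g. g \<in> C) * h)) = rs_integral n m x y"
  unfolding rs_integral_def
proof -
  obtain k where k: "k \<in> GL m" "h * k = 1\<^sub>m m" "k * h = 1\<^sub>m m" using GL_inverse[OF h] by metis
  have cancel: "(\<lambda>a. a * b) ` (\<lambda>a. a * c) ` C = C"
    if "C \<in> cosets" "c \<in> GL m" "b \<in> GL m" "c * b = 1\<^sub>m m" for C b c
  proof -
    obtain g where g: "g \<in> GL m" "C = {u * g | u. u \<in> Nuni m}" using \<open>C \<in> cosets\<close> by blast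
    have "g * c * b = g" using g that by (simp add: assoc_mult_mat[of _ m m _ m _ m] right_mult_one_mat[of _ m m])
    thus ?thesis using g that by (simp add: coset_translate)
  qed
  have tr: "(\<lambda>a. a * b) ` C \<in> cosets" if "C \<in> cosets" "b \<in> GL m" for C b
  proof -
    obtain g where g: "g \<in> GL m" "C = {u * g | u. u \<in> Nuni m}" using \<open>C \<in> cosets\<close> by blast
    show ?thesis unfolding g(2) coset_translate[OF g(1) that(2)]
      by (rule image_eqI[OF refl]) (use g that in simp)
  qed
  show "(\<Sum>C\<in>cosets. x (emb n m ((SOME g. g \<in> C) * h)) * y ((SOME g. g \<in> C) * h))
    = (\<Sum>C\<in>cosets. x (emb n m (SOME g. g \<in> C)) * y (SOME g. g \<in> C))"
  proof (rule sum.reindex_bij_witness[of _ "\<lambda>C. (\<lambda>a. a * k) ` C" "\<lambda>C. (\<lambda>a. a * h) ` C"])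
    fix C assume C: "C \<in> cosets"
    then obtain g where g: "g \<in> GL m" "C = {u * g | u. u \<in> Nuni m}" by auto
    let ?r = "SOME g. g \<in> C" and ?r' = "SOME g. g \<in> (\<lambda>a. a * h) ` C"
    have gh: "g * h \<in> GL m" using g h by simp
    have Ch: "(\<lambda>a. a * h) ` C = {u * (g * h) | u. u \<in> Nuni m}" using coset_translate g h by simp
    have "?r * h \<in> (\<lambda>a. a * h) ` C" using coset_rep[OF g(1)] g(2) by blast
    hence "x (emb n m (?r * h)) * y (?r * h) = x (emb n m (g * h)) * y (g * h)"
      unfolding Ch by (rule integrand_coset_rep[OF x y gh])
    moreover have "x (emb n m ?r') * y ?r' = x (emb n m (g * h)) * y (g * h)"
      unfolding Ch by (rule integrand_coset_rep[OF x y gh coset_rep[OF gh]])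
    ultimately show "x (emb n m ?r') * y ?r' = x (emb n m (?r * h)) * y (?r * h)" by simp
  qed (use cancel tr h k in auto)
qed

lemma rs_integral_equivariant: "H_equivariant psi n m W W' (rs_integral n m)"
  unfolding H_equivariant_def
proof (intro conjI ballI)
  show "bilinear_on W W' (rs_integral n m)"
    unfolding bilinear_on_def rs_integral_def
    by (simp add: sum.distrib sum_distrib_left algebra_simps)
next
  fix g u :: "'k mat" and x y assume g: "g \<in> GL m" and u: "u \<in> Uhn n m" and x: "x \<in> W" and y: "y \<in> W'"
  have uc: "u \<in> carrier_mat n n" "u \<in> GL n" using Uhn_Nuni[OF u] Nuni_carrier Nuni_GL by auto
  have "rs_integral n m (rt n (emb n m g * u) x) (rt m g y)
    = (\<Sum>C\<in>cosets. psiN psi n u * (x (emb n m ((SOME g. g \<in> C) * g)) * y ((SOME g. g \<in> C) * g)))"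
    unfolding rs_integral_def
  proof (rule sum.cong[OF refl])
    fix C assume C: "C \<in> cosets"
    define r where "r = (SOME g. g \<in> C)"
    have r: "r \<in> GL m" unfolding r_def by (rule coset_rep_GL[OF C])
    have rg: "r * g \<in> GL m" using r g by simp
    \<comment> \<open>u is conjugated to the left of the embedded matrix, where left equivariance of
      x turns it into a value of psi.\<close>
    obtain u' where u': "u' \<in> Uhn n m" "emb n m (r * g) * u = u' * emb n m (r * g)" "psiN psi n u' = psiN psi n u"
      by (rule Uhn_conjugate[OF GL_carrier[OF rg] u mn(2)])
    have "rt n (emb n m g * u) x (emb n m r) = x (emb n m r * (emb n m g * u))"
      using r mn by (simp add: rt_def)
    also have "emb n m r * (emb n m g * u) = emb n m (r * g) * u"
      using r g mn uc by (simp add: emb_mult assoc_mult_mat[of _ n n _ n _ n])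
    also have "x (emb n m (r * g) * u) = psiN psi n u * x (emb n m (r * g))"
      using left_W[OF x] u' Uhn_Nuni[OF u'(1)] rg mn by (simp add: left_equivariant_def)
    finally show "rt n (emb n m g * u) x (emb n m (SOME g. g \<in> C)) * rt m g y (SOME g. g \<in> C)
      = psiN psi n u * (x (emb n m ((SOME g. g \<in> C) * g)) * y ((SOME g. g \<in> C) * g))"
      using r by (simp add: rt_def flip: r_def)
  qed
  also have "\<dots> = psiN psi n u * rs_integral n m x y"
    using rs_integral_translate[OF left_W[OF x] left_W'[OF y] g] by (simp flip: sum_distrib_left)
  finally show "rs_integral n m (rt n (emb n m g * u) x) (rt m g y) = psiN psi n u * rs_integral n m x y" .
qed

text \<open>Since m < n, \<open>bessel_support\<close> leaves only the coset of the identity, where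
  the projectors do not alter the values. Attaining the value 1 makes the sum a generator over R and
  not merely a nonzero form.\<close>

lemma rs_integral_bessel:
  assumes x: "x \<in> W" and y: "y \<in> W'"
  shows "rs_integral n m (Q n (n - 1) x) (inv.Q m (m - 1) y) = x (1\<^sub>m n) * y (1\<^sub>m m)"
proof -
  let ?X = "Q n (n - 1) x" and ?Y = "inv.Q m (m - 1) y"
  let ?f = "\<lambda>C. ?X (emb n m (SOME g. g \<in> C)) * ?Y (SOME g. g \<in> C)"
  have X: "left_equivariant n ?X" using left_W[OF x] by (rule left_equivariant_Q) simp
  have Y: "inv.left_equivariant m ?Y" using left_W'[OF y] by (rule inv.left_equivariant_Q) simp
  \<comment> \<open>Written as the coset of the identity, the group has a chosen representative that
    can be compared with the identity.\<close>
  have N1: "(Nuni m :: 'k mat set) = {u * 1\<^sub>m m | u. u \<in> Nuni m}"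
    by (rule Nuni_coset[OF Nuni_one, symmetric])
  have Nc: "Nuni m \<in> cosets" by (subst N1) (use GL_one in blast)
  have "?f C = 0" if C: "C \<in> cosets" "C \<noteq> Nuni m" for C
  proof (rule ccontr)
    assume nz: "?f C \<noteq> 0"
    obtain g where g: "g \<in> GL m" "C = {u * g | u. u \<in> Nuni m}" using C by auto
    have "?f C = ?X (emb n m g) * ?Y g"
      using integrand_coset_rep[OF X Y g(1) coset_rep[OF g(1)]] g(2) by simp
    hence "?X (emb n m g) \<noteq> 0" using nz by auto
    hence "g \<in> Nuni m"
      using bessel_support[OF X right_equivariant_Q g(1) mn(2)] mn by simp
    hence "C = Nuni m" using Nuni_coset g(2) by simp
    thus False using C by simp
  qed
  hence "rs_integral n m ?X ?Y = (\<Sum>C\<in>{Nuni m}. ?f C)"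
    unfolding rs_integral_def using Nc by (intro sum.mono_neutral_right) auto
  also have "\<dots> = ?f {u * 1\<^sub>m m | u. u \<in> Nuni m}" using N1 by simp
  also have "\<dots> = ?X (emb n m (1\<^sub>m m)) * ?Y (1\<^sub>m m)"
    by (rule integrand_coset_rep[OF X Y GL_one coset_rep[OF GL_one]])
  also have "\<dots> = x (1\<^sub>m n) * y (1\<^sub>m m)"
    using mn Q_one[OF left_W[OF x], of "n - 1"] inv.Q_one[OF left_W'[OF y], of "m - 1"] by simp
  finally show ?thesis .
qed

lemma H_equivariant_diff:
  assumes "H_equivariant psi n m W W' F" "H_equivariant psi n m W W' G"
  shows "H_equivariant psi n m W W' (\<lambda>x y. F x y - r * G x y)"
  using assms unfolding H_equivariant_def bilinear_on_def
  by (simp add: algebra_simps)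

text \<open>By \<open>det\<close> and \<open>det'\<close>, the fully projected x and y are the
  multiples of \<open>?w\<close> and \<open>?w'\<close> by their values at the identity. On such
  pairs F and r times the sum agree, since the sum is 1 at \<open>?w\<close>, \<open>?w'\<close>;
  their difference is equivariant and hence zero on all of \<open>W\<close> and
  \<open>W'\<close>.\<close>

theorem H_equivariant_unique:
  assumes exc: "\<not> exceptional psi n m W W'"
    and w: "w \<in> W" "w (1\<^sub>m n) = 1" and w': "w' \<in> W'" "w' (1\<^sub>m m) = 1"
    and det: "\<And>x. x \<in> W \<Longrightarrow> x (1\<^sub>m n) = 0 \<Longrightarrow> Q n (n - 1) x = 0"
    and det': "\<And>y. y \<in> W' \<Longrightarrow> y (1\<^sub>m m) = 0 \<Longrightarrow> inv.Q m (m - 1) y = 0"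
    and F: "H_equivariant psi n m W W' F"
  shows "\<exists>!r. \<forall>x\<in>W. \<forall>y\<in>W'. F x y = r * rs_integral n m x y"
proof -
  let ?w = "Q n (n - 1) w" and ?w' = "inv.Q m (m - 1) w'"
  define r where "r = F ?w ?w'"
  have ww: "?w \<in> W" "?w' \<in> W'" using w w' by (auto intro: Q_in[OF W] inv.Q_in[OF W'])
  have Qx: "Q n (n - 1) x = fscale (x (1\<^sub>m n)) ?w" if "x \<in> W" for x
  proof -
    have "Q n (n - 1) (x - fscale (x (1\<^sub>m n)) w) = 0"
      by (rule det) (use w that fs.subspace_diff[OF sub(1)] fs.subspace_scale[OF sub(1)] in auto)
    thus ?thesis by (simp only: Q_diff Q_fscale right_minus_eq)
  qed
  have Qy: "inv.Q m (m - 1) y = fscale (y (1\<^sub>m m)) ?w'" if "y \<in> W'" for y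
  proof -
    have "inv.Q m (m - 1) (y - fscale (y (1\<^sub>m m)) w') = 0"
      by (rule det') (use w' that fs.subspace_diff[OF sub(2)] fs.subspace_scale[OF sub(2)] in auto)
    thus ?thesis by (simp only: inv.Q_diff inv.Q_fscale right_minus_eq)
  qed
  let ?G = "\<lambda>x y. F x y - r * rs_integral n m x y"
  have G: "H_equivariant psi n m W W' ?G"
    by (rule H_equivariant_diff[OF F rs_integral_equivariant])
  have "?G (Q n (n - 1) x) (inv.Q m (m - 1) y) = 0" if xy: "x \<in> W" "y \<in> W'" for x y
  proof -
    have "F (Q n (n - 1) x) (inv.Q m (m - 1) y) = x (1\<^sub>m n) * (y (1\<^sub>m m) * r)"
      unfolding Qx[OF xy(1)] Qy[OF xy(2)] r_def using ww fs.subspace_scale[OF sub(2) ww(2)]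
      by (simp only: bilinear_onD[OF F_bilinear[OF F]])
    thus ?thesis using rs_integral_bessel[OF xy] by (simp add: mult_ac)
  qed
  hence "?G x y = 0" if "x \<in> W" "y \<in> W'" for x y
    using F_eq_0_if_Q_eq_0[OF G exc _ that] by blast
  hence ex: "\<forall>x\<in>W. \<forall>y\<in>W'. F x y = r * rs_integral n m x y" by auto
  \<comment> \<open>Evaluating at \<open>?w\<close> and \<open>?w'\<close>, where the sum is 1,
    recovers the scalar.\<close>
  moreover have "s = r" if "\<forall>x\<in>W. \<forall>y\<in>W'. F x y = s * rs_integral n m x y" for s
    using that ww rs_integral_bessel[OF w(1) w'(1)] w w' unfolding r_def by simp
  ultimately show ?thesis by blast
qed

end

section \<open>Whittaker models of representations\<close>

context additive_character
begin

context
  fixes sc :: "'r \<Rightarrow> 'v::ab_group_add \<Rightarrow> 'v" and act :: "'k mat \<Rightarrow> 'v \<Rightarrow> 'v" and N :: nat and lam :: "'v \<Rightarrow> 'r"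
  assumes rep: "is_Gn_rep sc act N" and wh: "whitt_functional sc act psi N lam" and N: "0 < N"
begin

definition whitt_fun :: "'v \<Rightarrow> 'k mat \<Rightarrow> 'r" where
  "whitt_fun v = (\<lambda>g. if g \<in> GL N then lam (act g v) else 0)"

lemma whitt_model_eq: "whitt_model act N lam = range whitt_fun"
  by (auto simp: whitt_model_def whitt_fun_def)

lemma act_mult: "g \<in> GL N \<Longrightarrow> h \<in> GL N \<Longrightarrow> act (g * h) v = act g (act h v)"
  using rep by (simp add: is_Gn_rep_def)

lemma act_one: "act (1\<^sub>m N) v = v"
  using rep by (simp add: is_Gn_rep_def)

lemma lam_hom: "Modules.module_hom sc (*) lam"
  using wh by (simp add: whitt_functional_def)

lemma act_hom: "g \<in> GL N \<Longrightarrow> Modules.module_hom sc sc (act g)"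
  using rep by (simp add: is_Gn_rep_def)

lemma intertwiner_whitt_fun: "intertwiner psi sc act UNIV N whitt_fun"
proof -
  interpret M: Modules.module sc using rep by (simp add: is_Gn_rep_def)
  show ?thesis
  proof
    show "M.subspace UNIV" by simp
    show "whitt_fun (v + w) = whitt_fun v + whitt_fun w" for v w
      by (auto simp: whitt_fun_def fun_eq_iff module_hom.add[OF act_hom] module_hom.add[OF lam_hom])
    show "whitt_fun (sc r v) = fscale r (whitt_fun v)" for r v
      by (auto simp: whitt_fun_def fun_eq_iff module_hom.scale[OF act_hom] module_hom.scale[OF lam_hom])
    show "g \<in> GL N \<Longrightarrow> whitt_fun (act g v) = rt N g (whitt_fun v)" for g v
      by (auto simp: whitt_fun_def rt_def fun_eq_iff act_mult)
  qed auto
qed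

lemma invariant_space_whitt_model: "invariant_space N (whitt_model act N lam)"
proof -
  interpret intertwiner psi sc act UNIV N whitt_fun by (rule intertwiner_whitt_fun)
  have "fs.subspace (range whitt_fun)"
  proof (rule fs.subspaceI)
    show "0 \<in> range whitt_fun" using \<phi>_zero by (metis rangeI)
    show "x + y \<in> range whitt_fun" if "x \<in> range whitt_fun" "y \<in> range whitt_fun" for x y
      using that \<phi>_add[OF UNIV_I UNIV_I, symmetric] by (auto simp del: plus_fun_apply)
    show "fscale c x \<in> range whitt_fun" if "x \<in> range whitt_fun" for c x
      using that \<phi>_scale[OF UNIV_I, symmetric] by (auto simp del: fscale_apply)
  qed
  moreover have "rt N g (whitt_fun v) \<in> range whitt_fun" if "g \<in> GL N" for g v
    using \<phi>_act[OF that] by (metis UNIV_I rangeI)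
  ultimately show ?thesis
    unfolding invariant_space_def whitt_model_eq by (auto simp: whitt_fun_def)
qed

text \<open>The relation for U_s enters the kernel at stage N - s + 1, which is at most N - 1 for s
  \<ge> 2, and these kernels increase up to the kernel of \<open>lam\<close>. For s = 1 the group is
  trivial.\<close>

lemma lam_uelt:
  assumes s: "0 < s" "s \<le> N" and y: "y \<in> carrier_vec (s - 1)"
  shows "lam (act (uelt N s y) v) = psi (lastv (s - 1) \<bullet> y) * lam v"
proof (cases "s = 1")
  case True
  hence "y = 0\<^sub>v (s - 1)" using y by (intro eq_vecI) auto
  hence "umat s y = 1\<^sub>m s" using s by (simp only: umat_0)
  thus ?thesis using True s y by (simp add: act_one scalar_prod_def)
next
  case False
  interpret M: Modules.module sc using rep by (simp add: is_Gn_rep_def)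
  have mono: "phi_ker sc act UNIV psi N i \<subseteq> phi_ker sc act UNIV psi N j" if "i \<le> j" for i j
    using that by (induction rule: dec_induct) (auto intro: M.span_base)
  let ?a = "act (uelt N s y) v - sc (psi (lastv (s - 1) \<bullet> y)) v"
  have "N - (N - s) = s" using s by simp
  moreover have "umat s y \<in> Umir s" using Umir_eq_range_umat[OF s(1)] y by blast
  ultimately have "?a \<in> phi_ker sc act UNIV psi N (Suc (N - s))"
    using psiN_umat[OF s(1) y, of psi, symmetric]
    by (simp only: phi_ker.simps) (intro M.span_base UnI2 CollectI exI[of _ "umat s y"] exI[of _ v], simp)
  hence "?a \<in> phi_ker sc act UNIV psi N (N - 1)"
  proof -
    have "Suc (N - s) \<le> N - 1" using False s by linarith
    from mono[OF this] show ?thesis using \<open>?a \<in> phi_ker sc act UNIV psi N (Suc (N - s))\<close> by blast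
  qed
  hence "?a \<in> deriv_ker sc act UNIV psi N N"
    using N by (auto simp: deriv_ker_def intro!: M.span_base)
  hence "lam ?a = 0" using wh unfolding whitt_functional_def by blast
  thus ?thesis
    by (simp add: module_hom.diff[OF lam_hom] module_hom.scale[OF lam_hom])
qed

text \<open>N_j is U_j times N_(j-1), and psi is multiplicative along this factorisation.\<close>

lemma lam_Nuni:
  assumes "j \<le> N" "u \<in> Nuni j"
  shows "lam (act (emb N j u) v) = psiN psi j u * lam v"
  using assms
proof (induction j arbitrary: u v)
  case 0
  have "u = 1\<^sub>m 0" using Nuni_carrier[OF 0(2)] by auto
  thus ?case by (simp add: act_one psiN_def)
next
  case (Suc j)
  let ?y = "vec j (\<lambda>i. u $$ (i, j))" and ?h = "mat j j (\<lambda>x. u $$ x)"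
  have uc: "u \<in> carrier_mat (Suc j) (Suc j)" using Suc.prems by (simp add: Nuni_carrier)
  have h: "?h \<in> Nuni j" using Nuni_upper_left[OF Suc.prems(2)] by simp
  have dec: "u = umat (Suc j) ?y * emb (Suc j) j ?h"
    using last_row_decomp[OF uc] Nuni_last_row[OF Suc.prems(2)] by simp
  have "emb N (Suc j) u = uelt N (Suc j) ?y * emb N j ?h"
    by (subst dec) (use Suc.prems in \<open>simp add: emb_mult emb_emb\<close>)
  hence "lam (act (emb N (Suc j) u) v) = lam (act (uelt N (Suc j) ?y) (act (emb N j ?h) v))"
    using Suc.prems Nuni_GL[OF h] by (simp add: act_mult)
  also have "\<dots> = psi (lastv j \<bullet> ?y) * lam (act (emb N j ?h) v)"
    using lam_uelt[of "Suc j" ?y] Suc.prems by simp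
  also have "\<dots> = psi (lastv j \<bullet> ?y) * (psiN psi j ?h * lam v)"
    using Suc.IH[OF _ h] Suc.prems by simp
  also have "\<dots> = psiN psi (Suc j) u * lam v"
    using psiN_last_column[of "Suc j" u] by (simp add: mult.assoc)
  finally show ?case .
qed

lemma left_equivariant_whitt_model:
  assumes "x \<in> whitt_model act N lam"
  shows "left_equivariant N x"
proof -
  obtain v where v: "x = whitt_fun v" using assms whitt_model_eq by auto
  show ?thesis
    unfolding left_equivariant_def v
  proof (intro ballI)
    fix u g :: "'k mat" assume u: "u \<in> Nuni N" and g: "g \<in> GL N"
    have "emb N N u = u" using Nuni_carrier[OF u] by simp
    thus "whitt_fun v (u * g) = psiN psi N u * whitt_fun v g"
      using g Nuni_GL[OF u] lam_Nuni[OF le_refl u, of "act g v"] by (simp add: whitt_fun_def act_mult)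
  qed
qed

lemma whitt_model_one: "\<exists>w\<in>whitt_model act N lam. w (1\<^sub>m N) = 1"
proof -
  obtain v where "lam v = 1" using wh unfolding whitt_functional_def by (metis surjD)
  hence "whitt_fun v (1\<^sub>m N) = 1" by (simp add: whitt_fun_def act_one)
  thus ?thesis using whitt_model_eq by blast
qed

text \<open>The value at the identity is \<open>lam v\<close>. If it vanishes, v lies in the kernel
  of the top derivative, which the projectors annihilate.\<close>

lemma Q_whitt_model_eq_0:
  assumes "x \<in> whitt_model act N lam" "x (1\<^sub>m N) = 0"
  shows "Q N (N - 1) x = 0"
proof -
  interpret intertwiner psi sc act UNIV N whitt_fun by (rule intertwiner_whitt_fun)
  obtain v where v: "x = whitt_fun v" using assms whitt_model_eq by auto
  hence "lam v = 0" using assms by (simp add: whitt_fun_def act_one)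
  hence "v \<in> deriv_ker sc act UNIV psi N N" using wh unfolding whitt_functional_def by blast
  thus ?thesis unfolding v by (intro Q_deriv_ker_top N) (simp_all add: whitt_fun_def)
qed

end

end

section \<open>The module of equivariant forms on a pair of Whittaker models\<close>

theorem theorem3p1:
  fixes psi :: "'k::{field,finite} \<Rightarrow> 'r::comm_ring_1"
    and zeta :: 'r and tr :: "'k \<Rightarrow> nat" and n m :: nat
    and sc1 :: "'r \<Rightarrow> 'v::ab_group_add \<Rightarrow> 'v" and act1 :: "'k mat \<Rightarrow> 'v \<Rightarrow> 'v"
    and sc2 :: "'r \<Rightarrow> 'w::ab_group_add \<Rightarrow> 'w" and act2 :: "'k mat \<Rightarrow> 'w \<Rightarrow> 'w"
    and lam1 :: "'v \<Rightarrow> 'r" and lam2 :: "'w \<Rightarrow> 'r"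
  assumes noeth: "noetherian TYPE('r)"
    and p_unit: "\<exists>x::'r. of_nat CHAR('k) * x = 1"
    and zeta_cyclo: "(\<Sum>i<CHAR('k). zeta ^ i) = 0"
    and tr_range: "\<forall>a. tr a < CHAR('k)"
    and tr_add: "\<forall>a b. tr (a + b) = (tr a + tr b) mod CHAR('k)"
    and tr_nontriv: "\<exists>a. tr a \<noteq> 0"
    and psi_def: "psi = (\<lambda>a. zeta ^ tr a)"
    and mn: "1 \<le> m" "m < n"
    and rep1: "is_Gn_rep sc1 act1 n"
    and rep2: "is_Gn_rep sc2 act2 m"
    and wh1: "whitt_functional sc1 act1 psi n lam1"
    and wh2: "whitt_functional sc2 act2 (\<lambda>a. psi (- a)) m lam2"
    and not_exc: "\<not> exceptional psi n m (whitt_model act1 n lam1) (whitt_model act2 m lam2)"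
  shows "H_equivariant psi n m (whitt_model act1 n lam1) (whitt_model act2 m lam2)
           (rs_integral n m)
       \<and> (\<forall>F. H_equivariant psi n m (whitt_model act1 n lam1) (whitt_model act2 m lam2) F \<longrightarrow>
            (\<exists>!r. \<forall>x\<in>whitt_model act1 n lam1. \<forall>y\<in>whitt_model act2 m lam2.
                F x y = r * rs_integral n m x y))"
proof -
  interpret additive_character psi
    unfolding psi_def by (rule additive_character_root_of_unity[OF p_unit zeta_cyclo tr_range tr_add tr_nontriv])
  interpret inverse: additive_character "\<lambda>a. psi (- a)" by (rule inverse_character)
  have pos: "0 < n" "0 < m" using mn by auto
  note 1 = rep1 wh1 pos(1) and 2 = rep2 wh2 pos(2)
  interpret whittaker_pair psi n m "whitt_model act1 n lam1" "whitt_model act2 m lam2"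
    by unfold_locales (use mn invariant_space_whitt_model[OF 1] inverse.invariant_space_whitt_model[OF 2]
      left_equivariant_whitt_model[OF 1] inverse.left_equivariant_whitt_model[OF 2] in auto)
  obtain w where w: "w \<in> whitt_model act1 n lam1" "w (1\<^sub>m n) = 1" using whitt_model_one[OF 1] by blast
  obtain w' where w': "w' \<in> whitt_model act2 m lam2" "w' (1\<^sub>m m) = 1" using inverse.whitt_model_one[OF 2] by blast
  \<comment> \<open>Existence of r says that the sum generates the module of forms; uniqueness says
    that the module is free on it.\<close>
  show ?thesis
    using rs_integral_equivariant
      H_equivariant_unique[OF not_exc w w' Q_whitt_model_eq_0[OF 1] inverse.Q_whitt_model_eq_0[OF 2]]
    by blast
qed

end
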